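(* Let $0\leq s\leq m$ and let $\mu$ be a finite Radon measure in $\mathbb{R}^m$. Suppose that there is a set of positive $\mu$-measure such that for all $x$ in this set one has $0<\theta^{s,*}_\mu(x)<\infty$ and the limit $\lim_{\varepsilon\to 0} R^s_\varepsilon\mu(x)$ exists. Then $s\in\mathbb{Z}$.
   Context: Here $m$ is a positive integer and $s$ is a real number. For a Borel measure $\mu$ in $\mathbb{R}^m$ and $\varepsilon>0$, the truncated $s$-Riesz transform is the vector-valued function $$R^s_\varepsilon\mu(x)=\int_{|x-y|>\varepsilon}\frac{x-y}{|x-y|^{s+1}}\,d\mu(y),\qquad x\in\mathbb{R}^m.$$ The upper $s$-dimensional density of $\mu$ at $x$ is $$\theta^{s,*}_\mu(x)=\limsup_{r\to 0}\frac{\mu(B(x,r))}{r^s},$$ where $B(x,r)$ is the open ball of center $x$ and radius $r$. Existence of the limit means existence of a limit in $\mathbb{R}^m$ (i.e. finite). *)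

theory Defs
  imports "HOL-Analysis.Analysis"
begin

text \<open>
  On a Euclidean space the two regularity conditions follow from local finiteness; they are
  kept because they belong to the usual definition of a Radon measure.
\<close>

definition radon_measure :: "'a::t2_space measure \<Rightarrow> bool" where
  "radon_measure M \<longleftrightarrow>
     sets M = sets borel \<and>
     (\<forall>K. compact K \<longrightarrow> emeasure M K < \<infinity>) \<and>
     (\<forall>U. open U \<longrightarrow> emeasure M U = (SUP K\<in>{K. compact K \<and> K \<subseteq> U}. emeasure M K)) \<and>
     (\<forall>A\<in>sets borel. emeasure M A = (INF U\<in>{U. open U \<and> A \<subseteq> U}. emeasure M U))"

text \<open>
  If \<open>M\<close> is a finite Borel measure, \<open>0 \<le> s\<close> and \<open>0 < \<epsilon>\<close>, the integrand is bounded in norm by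
  \<open>\<epsilon> powr (-s)\<close>, so the Bochner integral below is never the default value
  for a non-integrable function.
\<close>

definition truncated_riesz ::
  "real \<Rightarrow> (real ^ 'm) measure \<Rightarrow> real \<Rightarrow> real ^ 'm \<Rightarrow> real ^ 'm" where
  "truncated_riesz s M \<epsilon> x =
     (LINT y:{y. norm (x - y) > \<epsilon>}|M. (x - y) /\<^sub>R (norm (x - y) powr (s + 1)))"

definition upper_density :: "real \<Rightarrow> 'a::metric_space measure \<Rightarrow> 'a \<Rightarrow> ennreal" where
  "upper_density s M x =
     Limsup (at_right 0) (\<lambda>r::real. emeasure M (ball x r) / ennreal (r powr s))"

end

theory Submission
  imports Defs "HOL-Probability.Distributions" "HOL-Real_Asymp.Real_Asymp"
begin

text \<open>
  Replace the sharp truncation by a Gaussian: existence of the principal value at \<open>x\<close> implies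
  \<open>t powr ((s + 1) / 2) * (\<integral>y. exp (- t * (norm (x - y))\<^sup>2) * (x - y) \<partial>M) \<longlonglongrightarrow> 0\<close> as \<open>t \<rightarrow> \<infinity>\<close>. Blowing
  up \<open>M\<close> at a point where this holds and the densities are controlled gives a measure \<open>N\<close> with
  \<open>N (ball x r) \<le> C * r powr s\<close> at the points \<open>x\<close> of a set \<open>F\<close> that carries almost all of the mass
  of the unit ball, and whose Gaussian transforms at these points are nearly zero.

  For \<open>v \<in> F\<close>, expanding \<open>exp (- t * (norm (v - y))\<^sup>2)\<close> to first order in \<open>v\<close> shows that the matrix
  \<open>2 * t * (\<integral>y. (y \<otimes> y) * exp (- t * (norm y)\<^sup>2) \<partial>N)\<close> acts on \<open>v\<close> almost as multiplication by
  \<open>g t = (\<integral>y. exp (- t * (norm y)\<^sup>2) \<partial>N)\<close>. If \<open>s\<close> is not an integer, the growth bound prevents \<open>F\<close> from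
  lying near a subspace of dimension at most \<open>\<lfloor>s\<rfloor>\<close>, so this matrix has trace at least about \<open>d * g t\<close>
  with \<open>d = \<lfloor>s\<rfloor> + 1 > s\<close>. The trace is \<open>- 2 * t * g' t\<close>, so \<open>g\<close> grows like \<open>t powr (- d / 2)\<close> as \<open>t\<close>
  decreases, against the upper bound \<open>g t \<le> K * t powr (- s / 2)\<close>.
\<close>

section \<open>Gaussian integrals and covering by small balls\<close>

lemma summable_gaussian_weights:
  fixes s :: real
  shows "summable (\<lambda>k. exp (- (real k)\<^sup>2) * (real k + 1) powr s)"
proof (rule summable_comparison_test_bigo)
  show "summable (\<lambda>k. norm (1 / (real k)\<^sup>2))"
    using inverse_power_summable[of 2, where 'a=real] by (simp add: inverse_eq_divide)
  show "(\<lambda>k. exp (- (real k)\<^sup>2) * (real k + 1) powr s) \<in> O(\<lambda>k. 1 / (real k)\<^sup>2)"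
    by real_asymp
qed

lemma integrable_gaussian:
  fixes N :: "'a::euclidean_space measure"
  assumes "finite_measure N" and [measurable_cong]: "sets N = sets borel" and "t \<ge> 0"
  shows "integrable N (\<lambda>y. exp (- t * (norm (y - x))\<^sup>2))"
proof -
  interpret finite_measure N by fact
  show ?thesis
    by (rule integrable_const_bound[where B=1]) (use \<open>t \<ge> 0\<close> in auto)
qed

text \<open>Cut space into the shells \<open>k \<le> sqrt t * norm y < k + 1\<close>. On the
  \<open>k\<close>-th shell the Gaussian is at most \<open>exp (- k^2)\<close>, and the shell lies
  in the ball of radius \<open>(k + 1) / sqrt t\<close>, whose mass is at most
  \<open>C * (k + 1) powr s * t powr (- s / 2)\<close>. The sum over \<open>k\<close> is a constant
  independent of \<open>t\<close>. Growth is assumed only for balls centred at the origin.\<close>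

lemma gaussian_integral_growth:
  fixes N :: "'a::euclidean_space measure"
  assumes "finite_measure N" and sN [measurable_cong]: "sets N = sets borel"
    and gr: "\<And>r. r > 0 \<Longrightarrow> measure N (ball 0 r) \<le> C * r powr s"
    and "t > 0"
  shows "(\<integral>y. exp (- t * (norm y)\<^sup>2) \<partial>N)
    \<le> C * (\<Sum>k. exp (- (real k)\<^sup>2) * (real k + 1) powr s) * t powr (- s / 2)"
proof -
  interpret finite_measure N by fact
  let ?a = "\<lambda>k::nat. exp (- (real k)\<^sup>2) * (real k + 1) powr s"
  let ?r = "\<lambda>k::nat. (real k + 1) / sqrt t"
  have C: "0 \<le> C" using order_trans[OF measure_nonneg gr[of 1]] by simp
  have pw: "ennreal (exp (- t * (norm y)\<^sup>2))
      \<le> (\<Sum>k. ennreal (exp (- (real k)\<^sup>2)) * indicator (ball 0 (?r k)) y)" for y :: 'a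
  proof -
    define f where "f k = ennreal (exp (- (real k)\<^sup>2)) * indicator (ball 0 (?r k)) y" for k
    define k where "k = nat \<lfloor>sqrt t * norm y\<rfloor>"
    have k: "real k \<le> sqrt t * norm y" "sqrt t * norm y < real k + 1"
      using \<open>t > 0\<close> by (auto simp: k_def)
    have "(real k)\<^sup>2 \<le> (sqrt t * norm y)\<^sup>2"
      using k by (intro power_mono) auto
    then have "exp (- t * (norm y)\<^sup>2) \<le> exp (- (real k)\<^sup>2)"
      using \<open>t > 0\<close> by (simp add: power_mult_distrib)
    moreover have "y \<in> ball 0 (?r k)"
      using k(2) \<open>t > 0\<close> by (simp add: field_simps)
    ultimately have "ennreal (exp (- t * (norm y)\<^sup>2)) \<le> f k"
      by (simp add: f_def ennreal_leI)
    also have "\<dots> \<le> (\<Sum>j. f j)"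
      using sum_le_suminf[of f "{k}"] by simp
    finally show ?thesis unfolding f_def .
  qed
  have pos: "0 \<le> (\<Sum>k. ?a k)" by (intro suminf_nonneg summable_gaussian_weights) simp
  have "ennreal (\<integral>y. exp (- t * (norm y)\<^sup>2) \<partial>N) = (\<integral>\<^sup>+y. ennreal (exp (- t * (norm y)\<^sup>2)) \<partial>N)"
    using integrable_gaussian[OF assms(1,2), of t 0] \<open>t > 0\<close>
    by (intro nn_integral_eq_integral[symmetric]) auto
  also have "\<dots> \<le> (\<integral>\<^sup>+y. (\<Sum>k. ennreal (exp (- (real k)\<^sup>2)) * indicator (ball 0 (?r k)) y) \<partial>N)"
    by (intro nn_integral_mono pw)
  also have "\<dots> = (\<Sum>k. (\<integral>\<^sup>+y. ennreal (exp (- (real k)\<^sup>2)) * indicator (ball 0 (?r k)) y \<partial>N))"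
    by (intro nn_integral_suminf borel_measurable_times_ennreal borel_measurable_const
        borel_measurable_indicator) (simp add: sN)
  also have "\<dots> = (\<Sum>k. ennreal (exp (- (real k)\<^sup>2)) * emeasure N (ball 0 (?r k)))"
    by (intro suminf_cong nn_integral_cmult_indicator) (simp add: sN)
  also have "\<dots> \<le> (\<Sum>k. ennreal (C * t powr (-s/2) * ?a k))"
  proof (intro suminf_le allI)
    fix k :: nat
    have rk: "?r k > 0" using \<open>t > 0\<close> by simp
    have "ennreal (exp (- (real k)\<^sup>2)) * emeasure N (ball 0 (?r k))
        = ennreal (exp (- (real k)\<^sup>2) * measure N (ball 0 (?r k)))"
      by (simp add: emeasure_eq_measure ennreal_mult)
    also have "\<dots> \<le> ennreal (exp (- (real k)\<^sup>2) * (C * (?r k) powr s))"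
      by (intro ennreal_leI mult_left_mono gr rk) simp
    also have "(?r k) powr s = (real k + 1) powr s * t powr (-s/2)"
      using \<open>t > 0\<close> by (simp add: powr_divide powr_half_sqrt[symmetric] powr_powr powr_minus_divide)
    finally show "ennreal (exp (- (real k)\<^sup>2)) * emeasure N (ball 0 (?r k))
        \<le> ennreal (C * t powr (-s/2) * ?a k)"
      by (simp add: mult_ac)
  qed auto
  also have "\<dots> = ennreal (\<Sum>k. C * t powr (-s/2) * ?a k)"
    using C by (intro suminf_ennreal2 summable_mult summable_gaussian_weights) auto
  also have "(\<Sum>k. C * t powr (-s/2) * ?a k) = C * (\<Sum>k. ?a k) * t powr (-s/2)"
    by (subst suminf_mult[OF summable_gaussian_weights]) (simp add: mult_ac)
  finally show ?thesis
    using C pos by (subst (asm) ennreal_le_iff) auto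
qed

text \<open>Round the coordinates of the projection to the span of \<open>B\<close> to a grid of
  side \<open>\<delta>\<close>. At most \<open>(5 / \<delta>) ^ card B\<close> cells occur, and two
  points of \<open>X\<close> in the same cell are closer than
  \<open>(card B + 3) * \<delta>\<close>: at most \<open>card B * \<delta>\<close> between the
  projections, and less than \<open>\<delta>\<close> from each point to its own projection. The
  covering balls are centred at points of \<open>X\<close> because the growth bound is available
  only there. For \<open>card B < s\<close> the resulting bound tends to \<open>0\<close> with
  \<open>\<delta>\<close>.\<close>

lemma measure_near_subspace_le:
  fixes N :: "'a::euclidean_space measure" and B :: "'a set"
  assumes "finite_measure N" and sN: "sets N = sets borel"
    and gr: "\<And>x r. x \<in> X \<Longrightarrow> r > 0 \<Longrightarrow> measure N (ball x r) \<le> C * r powr s"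
    and B: "finite B" "pairwise orthogonal B" "\<And>e. e \<in> B \<Longrightarrow> norm e = 1"
    and X: "X \<in> sets borel" "\<And>v. v \<in> X \<Longrightarrow> norm v < 1"
    and \<delta>: "0 < \<delta>" "\<delta> \<le> 1"
    and near: "\<And>v. v \<in> X \<Longrightarrow> norm (v - (\<Sum>e\<in>B. (v \<bullet> e) *\<^sub>R e)) < \<delta>"
    and "0 \<le> C"
  shows "measure N X \<le> C * (5 / \<delta>) ^ card B * ((real (card B) + 3) * \<delta>) powr s"
proof -
  interpret finite_measure N by fact
  let ?R = "(real (card B) + 3) * \<delta>"
  define P where "P v = (\<Sum>e\<in>B. (v \<bullet> e) *\<^sub>R e)" for v
  define \<phi> where "\<phi> v = restrict (\<lambda>e. \<lfloor>(v \<bullet> e) / \<delta>\<rfloor>) B" for v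
  define K where "K = \<lceil>1 / \<delta>\<rceil>"
  have K: "1 / \<delta> \<le> of_int K" "of_int K < 1/\<delta> + 1" unfolding K_def by linarith+
  have R: "?R > 0" using \<delta> by (intro mult_pos_pos) auto
  have img: "\<phi> ` X \<subseteq> PiE B (\<lambda>_. {-K..K})"
  proof (rule image_subsetI)
    fix v assume v: "v \<in> X"
    show "\<phi> v \<in> PiE B (\<lambda>_. {-K..K})"
    proof (rule PiE_I)
      fix e assume e: "e \<in> B"
      have "\<bar>v \<bullet> e\<bar> \<le> norm v * norm e" by (rule Cauchy_Schwarz_ineq2)
      then have "\<bar>v \<bullet> e\<bar> \<le> 1" using X(2)[OF v] B(3)[OF e] by auto
      then have "\<bar>(v \<bullet> e) / \<delta>\<bar> \<le> 1 / \<delta>" using \<delta> by (simp add: divide_right_mono)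
      then have "\<bar>(v \<bullet> e) / \<delta>\<bar> \<le> of_int K" using K by linarith
      then have "-K \<le> \<lfloor>(v \<bullet> e) / \<delta>\<rfloor>" "\<lfloor>(v \<bullet> e) / \<delta>\<rfloor> \<le> K" by linarith+
      then show "\<phi> v e \<in> {-K..K}" using e by (simp add: \<phi>_def)
    qed (auto simp: \<phi>_def)
  qed
  have finPi: "finite (PiE B (\<lambda>_. {-K..K}))" using B by (intro finite_PiE) auto
  have fin: "finite (\<phi> ` X)" using finite_subset[OF img finPi] .
  have "real (card (\<phi> ` X)) \<le> real (card (PiE B (\<lambda>_. {-K..K})))"
    using card_mono[OF finPi img] by simp
  also have "\<dots> = real (nat (2*K+1)) ^ card B"
    using B(1) by (subst card_PiE) (auto simp: algebra_simps)
  also have "\<dots> \<le> (5 / \<delta>) ^ card B"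
  proof (intro power_mono)
    have "1 \<le> 1 / \<delta>" using \<delta> by simp
    then have "2 * real_of_int K + 1 \<le> 5 * (1/\<delta>)" "real_of_int K \<ge> 0" using K by linarith+
    then show "real (nat (2*K+1)) \<le> 5 / \<delta>" by simp
  qed auto
  finally have card: "real (card (\<phi> ` X)) \<le> (5 / \<delta>) ^ card B" .
  define p where "p c = (SOME v. v \<in> X \<and> \<phi> v = c)" for c
  have p: "p c \<in> X \<and> \<phi> (p c) = c" if "c \<in> \<phi> ` X" for c
    unfolding p_def by (rule someI_ex) (use that in auto)
  have close: "dist v w < ?R" if "v \<in> X" "w \<in> X" "\<phi> v = \<phi> w" for v w
  proof -
    have "norm (P v - P w) \<le> (\<Sum>e\<in>B. norm (((v - w) \<bullet> e) *\<^sub>R e))"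
      unfolding P_def sum_subtractf[symmetric] by (rule order_trans[OF _ norm_sum])
        (simp add: algebra_simps inner_diff_left)
    also have "\<dots> \<le> (\<Sum>e\<in>B. \<delta>)"
    proof (rule sum_mono)
      fix e assume e: "e \<in> B"
      have "\<lfloor>(v \<bullet> e) / \<delta>\<rfloor> = \<lfloor>(w \<bullet> e) / \<delta>\<rfloor>"
        using fun_cong[OF that(3), of e] e by (simp add: \<phi>_def)
      then have "\<bar>(v \<bullet> e) / \<delta> - (w \<bullet> e) / \<delta>\<bar> < 1" by linarith
      then have "\<bar>(v - w) \<bullet> e\<bar> < \<delta>"
        using \<delta> by (simp add: diff_divide_distrib[symmetric] inner_diff_left[symmetric])
      then show "norm (((v - w) \<bullet> e) *\<^sub>R e) \<le> \<delta>" using B(3)[OF e] by simp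
    qed
    finally have "norm (P v - P w) \<le> real (card B) * \<delta>" by simp
    moreover have "norm (v - P v) < \<delta>" "norm (w - P w) < \<delta>"
      using near that by (auto simp: P_def)
    moreover have "dist v w \<le> norm (v - P v) + norm (P v - P w) + norm (w - P w)"
      using dist_triangle[of v w "P v"] dist_triangle[of "P v" w "P w"]
      by (simp add: dist_norm norm_minus_commute)
    ultimately show ?thesis using \<delta> by (simp add: algebra_simps)
  qed
  have sub: "X \<subseteq> (\<Union>c\<in>\<phi> ` X. ball (p c) ?R)"
  proof
    fix v assume v: "v \<in> X"
    then have "dist (p (\<phi> v)) v < ?R" using p[of "\<phi> v"] by (intro close) auto
    then show "v \<in> (\<Union>c\<in>\<phi> ` X. ball (p c) ?R)" using v by auto
  qed
  have "measure N X \<le> measure N (\<Union>c\<in>\<phi> ` X. ball (p c) ?R)"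
    using fin by (intro finite_measure_mono sub) (simp add: sN open_UN)
  also have "\<dots> \<le> (\<Sum>c\<in>\<phi> ` X. measure N (ball (p c) ?R))"
    using fin by (intro finite_measure_subadditive_finite) (auto simp: sN)
  also have "\<dots> \<le> (\<Sum>c\<in>\<phi> ` X. C * ?R powr s)"
    using p R by (intro sum_mono gr) auto
  also have "\<dots> = real (card (\<phi> ` X)) * (C * ?R powr s)" by simp
  also have "\<dots> \<le> (5 / \<delta>) ^ card B * (C * ?R powr s)"
    using card \<open>0 \<le> C\<close> by (intro mult_right_mono) auto
  finally show ?thesis by (simp add: mult_ac)
qed

text \<open>The summand \<open>(1 + j * gram_schmidt_const \<delta> j) / \<delta>\<close> is the
  cost of one new unit vector: one term for the chosen point, \<open>j\<close> projection terms with
  coefficients of modulus at most 1, and a division by a length of at least \<open>\<delta>\<close>.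
  Adding it to the previous value gives a single constant for old and new vectors.\<close>

fun gram_schmidt_const :: "real \<Rightarrow> nat \<Rightarrow> real" where
  "gram_schmidt_const \<delta> 0 = 0"
| "gram_schmidt_const \<delta> (Suc j) = gram_schmidt_const \<delta> j + (1 + real j * gram_schmidt_const \<delta> j) / \<delta>"

lemma gram_schmidt_const_nonneg: "\<delta> > 0 \<Longrightarrow> 0 \<le> gram_schmidt_const \<delta> j"
  by (induction j) auto

text \<open>
  Greedy choice of points of \<open>X\<close> far from the span of the previous ones; orthonormalizing them
  costs only a constant depending on \<open>\<delta>\<close> and \<open>d\<close> in the bound on \<open>D\<close>.
\<close>
lemma gram_schmidt_approx:
  fixes D :: "'i \<Rightarrow> 'a::euclidean_space \<Rightarrow> 'b \<Rightarrow> real"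
  assumes \<delta>: "\<delta> > 0"
    and lin: "\<And>t w. t \<in> I \<Longrightarrow> linear (\<lambda>v. D t v w)"
    and X: "\<And>v. v \<in> X \<Longrightarrow> norm v < 1"
    and small: "\<And>t v w. t \<in> I \<Longrightarrow> v \<in> X \<Longrightarrow> \<bar>D t v w\<bar> \<le> E t w"
    and far: "\<And>B. finite B \<Longrightarrow> pairwise orthogonal B \<Longrightarrow> (\<And>e. e \<in> B \<Longrightarrow> norm e = 1)
       \<Longrightarrow> card B < d \<Longrightarrow> \<exists>v\<in>X. norm (v - (\<Sum>e\<in>B. (v \<bullet> e) *\<^sub>R e)) \<ge> \<delta>"
    and "j \<le> d"
  shows "\<exists>B. finite B \<and> card B = j \<and> pairwise orthogonal B \<and> (\<forall>e\<in>B. norm e = 1)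
     \<and> (\<forall>t\<in>I. \<forall>e\<in>B. \<forall>w. \<bar>D t e w\<bar> \<le> gram_schmidt_const \<delta> j * E t w)"
  using \<open>j \<le> d\<close>
proof (induction j)
  case 0
  show ?case by (intro exI[of _ "{}"]) simp
next
  case (Suc j)
  let ?L = "gram_schmidt_const \<delta> j"
  have L: "0 \<le> ?L" by (rule gram_schmidt_const_nonneg[OF \<delta>])
  from Suc obtain B where B: "finite B" "card B = j" "pairwise orthogonal B" "\<And>e. e \<in> B \<Longrightarrow> norm e = 1"
    and small_B: "\<And>t e w. t \<in> I \<Longrightarrow> e \<in> B \<Longrightarrow> \<bar>D t e w\<bar> \<le> ?L * E t w"
    by auto
  obtain v where v: "v \<in> X" and dist: "norm (v - (\<Sum>e\<in>B. (v \<bullet> e) *\<^sub>R e)) \<ge> \<delta>"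
    using far[OF B(1,3,4)] B(2) Suc.prems by auto
  define u where "u = v - (\<Sum>e\<in>B. (v \<bullet> e) *\<^sub>R e)"
  define f where "f = u /\<^sub>R norm u"
  have nu: "norm u \<ge> \<delta>" "norm u > 0" using dist \<delta> by (auto simp: u_def)
  have orth: "u \<bullet> e = 0" if e: "e \<in> B" for e
  proof -
    have "(\<Sum>e'\<in>B. (v \<bullet> e') *\<^sub>R e') \<bullet> e = (\<Sum>e'\<in>B. if e' = e then v \<bullet> e else 0)"
      unfolding inner_sum_left using B(3) B(4)[OF e] e
      by (intro sum.cong) (auto simp: pairwise_def orthogonal_def norm_eq_1)
    also have "\<dots> = v \<bullet> e" using B(1) e by simp
    finally show ?thesis by (simp add: u_def inner_diff_left)
  qed
  have f: "norm f = 1" using nu by (simp add: f_def)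
  have orthf: "f \<bullet> e = 0" if "e \<in> B" for e using orth[OF that] by (simp add: f_def)
  have fB: "f \<notin> B" using orthf[of f] f by (auto simp: norm_eq_1)
  have small_f: "\<bar>D t f w\<bar> \<le> (1 + real j * ?L) / \<delta> * E t w" if t: "t \<in> I" for t w
  proof -
    interpret linear "\<lambda>v. D t v w" by (rule lin[OF t])
    have E: "0 \<le> E t w" using small[OF t v, of w] by linarith
    have "D t u w = D t v w - (\<Sum>e\<in>B. (v \<bullet> e) * D t e w)"
      unfolding u_def by (simp add: diff sum scale)
    also have "\<bar>\<dots>\<bar> \<le> \<bar>D t v w\<bar> + (\<Sum>e\<in>B. \<bar>(v \<bullet> e) * D t e w\<bar>)"
      using sum_abs[of "\<lambda>e. (v \<bullet> e) * D t e w" B] by linarith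
    also have "\<dots> \<le> E t w + (\<Sum>e\<in>B. ?L * E t w)"
    proof (intro add_mono small t v sum_mono)
      fix e assume e: "e \<in> B"
      have "\<bar>v \<bullet> e\<bar> \<le> norm v * norm e" by (rule Cauchy_Schwarz_ineq2)
      then have "\<bar>v \<bullet> e\<bar> \<le> 1" using X[OF v] B(4)[OF e] by auto
      then have "\<bar>v \<bullet> e\<bar> * \<bar>D t e w\<bar> \<le> 1 * (?L * E t w)"
        by (intro mult_mono small_B[OF t e]) auto
      then show "\<bar>(v \<bullet> e) * D t e w\<bar> \<le> ?L * E t w" by (simp add: abs_mult)
    qed
    also have "\<dots> = (1 + real j * ?L) * E t w" using B(2) by (simp add: algebra_simps)
    finally have 1: "\<bar>D t u w\<bar> \<le> (1 + real j * ?L) * E t w" .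
    have "\<bar>D t f w\<bar> = \<bar>D t u w\<bar> / norm u"
      unfolding f_def by (simp add: scale abs_mult divide_inverse mult.commute)
    also have "\<dots> \<le> (1 + real j * ?L) * E t w / \<delta>"
      using 1 nu \<delta> E L by (intro frac_le) auto
    finally show ?thesis by simp
  qed
  have E0: "0 \<le> E t w" if "t \<in> I" for t w using small[OF that v, of w] by linarith
  show ?case
  proof (intro exI[of _ "insert f B"] conjI ballI allI)
    show "finite (insert f B)" using B by simp
    show "card (insert f B) = Suc j" using B fB by simp
    show "pairwise orthogonal (insert f B)"
      using B(3) orthf by (auto simp: pairwise_insert orthogonal_def inner_commute)
    show "norm e = 1" if "e \<in> insert f B" for e using that f B by auto
    fix t e w assume t: "t \<in> I" and e: "e \<in> insert f B"
    have "\<bar>D t e w\<bar> \<le> ?L * E t w \<or> \<bar>D t e w\<bar> \<le> (1 + real j * ?L) / \<delta> * E t w"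
      using e small_B[OF t] small_f[OF t] by auto
    moreover have "0 \<le> ?L * E t w" "0 \<le> (1 + real j * ?L) / \<delta> * E t w"
      using L \<delta> E0[OF t] by auto
    ultimately have "\<bar>D t e w\<bar> \<le> ?L * E t w + (1 + real j * ?L) / \<delta> * E t w" by linarith
    then show "\<bar>D t e w\<bar> \<le> gram_schmidt_const \<delta> (Suc j) * E t w"
      by (simp only: gram_schmidt_const.simps distrib_right)
  qed
qed

section \<open>First-order expansion of the Gaussian Riesz transform\<close>

lemma exp_minus_one_bound: "\<bar>exp z - 1\<bar> \<le> \<bar>z\<bar> * exp \<bar>z\<bar>" for z :: real
proof (cases "z \<ge> 0")
  case True
  have "1 - z \<le> exp (-z)" using exp_ge_add_one_self[of "-z"] by simp
  then have "(1 - z) * exp z \<le> exp (-z) * exp z" by (intro mult_right_mono) auto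
  then show ?thesis using True by (simp add: exp_minus algebra_simps)
next
  case False
  have "1 - exp z \<le> - z" using exp_ge_add_one_self[of z] by linarith
  also have "\<dots> * 1 \<le> - z * exp (- z)" using False by (intro mult_left_mono) auto
  finally show ?thesis using False by simp
qed

text \<open>From \<open>(1 - z) * exp z \<le> 1\<close> follows
  \<open>exp z - 1 - z \<le> z * (exp z - 1)\<close>, which reduces the second-order bound to the
  first-order one.\<close>

lemma exp_taylor_bound: "\<bar>exp z - 1 - z\<bar> \<le> z\<^sup>2 * exp \<bar>z\<bar>" for z :: real
proof -
  have "1 - z \<le> exp (-z)" using exp_ge_add_one_self[of "-z"] by simp
  then have "(1 - z) * exp z \<le> exp (-z) * exp z" by (intro mult_right_mono) auto
  then have "exp z - 1 - z \<le> z * (exp z - 1)" by (simp add: exp_minus algebra_simps)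
  also have "\<dots> \<le> \<bar>z\<bar> * \<bar>exp z - 1\<bar>" by (metis abs_ge_self abs_mult)
  also have "\<dots> \<le> \<bar>z\<bar> * (\<bar>z\<bar> * exp \<bar>z\<bar>)"
    by (intro mult_left_mono exp_minus_one_bound) auto
  also have "\<dots> = z\<^sup>2 * exp \<bar>z\<bar>" by (simp add: power2_eq_square)
  finally show ?thesis using exp_ge_add_one_self[of z] by linarith
qed

text \<open>
  No doubling is available for \<open>N\<close>, so the factor polynomial in \<open>u = sqrt t * norm y\<close> is not absorbed
  into a wider Gaussian everywhere: it is at most a constant for \<open>u \<le> A\<close>, and only the tail \<open>u > A\<close>
  is widened, which gains \<open>exp (- A\<^sup>2 / 4)\<close>.
\<close>
lemma gaussian_remainder_bound:
  fixes v w y :: "'a::real_inner"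
  assumes t: "0 < t" "t \<le> 1" and v: "norm v \<le> 1" and A: "0 \<le> A"
  defines "z \<equiv> 2 * t * (v \<bullet> y)"
  shows "\<bar>(v \<bullet> w) * (exp z - 1) - (y \<bullet> w) * (exp z - 1 - z)\<bar> * exp (- t * (norm y)\<^sup>2)
    \<le> norm w * sqrt t * ((2 * A + 4 * A ^ 3) * exp (2 * sqrt t * A) * exp (- t * (norm y)\<^sup>2)
        + 110 * exp 9 * exp (- A\<^sup>2 / 4) * exp (- (t / 2) * (norm y)\<^sup>2))"
proof -
  define u where "u = sqrt t * norm y"
  have u: "0 \<le> u" "u\<^sup>2 = t * (norm y)\<^sup>2" using t by (auto simp: u_def power_mult_distrib)
  have "\<bar>v \<bullet> y\<bar> \<le> norm v * norm y" by (rule Cauchy_Schwarz_ineq2)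
  also have "\<dots> \<le> 1 * norm y" by (intro mult_right_mono v) simp
  finally have "\<bar>z\<bar> \<le> 2 * t * norm y" using t by (simp add: z_def abs_mult)
  also have "2 * t * norm y = 2 * sqrt t * u" using t by (simp add: u_def)
  finally have z: "\<bar>z\<bar> \<le> 2 * sqrt t * u" .
  have "z\<^sup>2 = \<bar>z\<bar>\<^sup>2" by simp
  also have "\<dots> \<le> (2 * sqrt t * u)\<^sup>2" by (intro power_mono z) simp
  also have "\<dots> = 4 * t * u\<^sup>2" using t by (simp add: power_mult_distrib)
  finally have z2: "z\<^sup>2 \<le> 4 * t * u\<^sup>2" .
  have vw: "\<bar>v \<bullet> w\<bar> \<le> norm w"
    using Cauchy_Schwarz_ineq2[of v w] mult_right_mono[OF v norm_ge_zero[of w]] by linarith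
  let ?e = "exp (2 * sqrt t * u)"
  have ez: "exp \<bar>z\<bar> \<le> ?e" using z by simp
  have "\<bar>(v \<bullet> w) * (exp z - 1) - (y \<bullet> w) * (exp z - 1 - z)\<bar>
     \<le> \<bar>v \<bullet> w\<bar> * \<bar>exp z - 1\<bar> + \<bar>y \<bullet> w\<bar> * \<bar>exp z - 1 - z\<bar>"
    by (metis abs_triangle_ineq4 abs_mult)
  also have "\<dots> \<le> norm w * (\<bar>z\<bar> * exp \<bar>z\<bar>) + (norm y * norm w) * (z\<^sup>2 * exp \<bar>z\<bar>)"
    by (intro add_mono mult_mono vw exp_minus_one_bound exp_taylor_bound Cauchy_Schwarz_ineq2) auto
  also have "\<dots> \<le> norm w * ((2 * sqrt t * u) * ?e) + (norm y * norm w) * ((4 * t * u\<^sup>2) * ?e)"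
    using t u by (intro add_mono mult_left_mono mult_mono z z2 ez) auto
  also have "\<dots> = norm w * sqrt t * ((2 * u + 4 * u ^ 3) * ?e)"
  proof -
    have "norm y * t = sqrt t * u" using t by (simp add: u_def mult_ac)
    then have "norm y * (4 * t * u\<^sup>2) = sqrt t * (4 * u ^ 3)"
      by (simp add: power2_eq_square power3_eq_cube mult_ac)
    then show ?thesis by (simp add: algebra_simps)
  qed
  finally have 1: "\<bar>(v \<bullet> w) * (exp z - 1) - (y \<bullet> w) * (exp z - 1 - z)\<bar>
    \<le> norm w * sqrt t * ((2 * u + 4 * u ^ 3) * ?e)" .
  have 2: "(2 * u + 4 * u ^ 3) * ?e * exp (- u\<^sup>2)
     \<le> (2 * A + 4 * A ^ 3) * exp (2 * sqrt t * A) * exp (- u\<^sup>2)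
       + 110 * exp 9 * exp (- A\<^sup>2 / 4) * exp (- u\<^sup>2 / 2)"
  proof (cases "u \<le> A")
    case True
    have "2 * u + 4 * u ^ 3 \<le> 2 * A + 4 * A ^ 3"
      using True u by (intro add_mono mult_left_mono power_mono) auto
    moreover have "?e \<le> exp (2 * sqrt t * A)" using True t by simp
    ultimately have "(2 * u + 4 * u ^ 3) * ?e * exp (- u\<^sup>2)
      \<le> (2 * A + 4 * A ^ 3) * exp (2 * sqrt t * A) * exp (- u\<^sup>2)"
      using A u by (intro mult_mono) auto
    then show ?thesis by (simp add: add_increasing2)
  next
    case False
    have "u / 3 \<le> exp (u / 3)" using exp_ge_add_one_self[of "u / 3"] by linarith
    then have "(u / 3) ^ 3 \<le> exp (u / 3) ^ 3" using u by (intro power_mono) auto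
    also have "\<dots> = exp u" by (simp flip: exp_of_nat_mult)
    \<comment> \<open>The constant 110 is \<open>2 + 4 * 27\<close>, using also
      \<open>u \<le> exp u\<close>.\<close>
    finally have "u ^ 3 \<le> 27 * exp u" by (simp add: power_divide)
    then have "2 * u + 4 * u ^ 3 \<le> 110 * exp u"
      using exp_ge_add_one_self[of u] by linarith
    moreover have "?e \<le> exp (2 * u)"
      using t u mult_right_mono[of "sqrt t" 1 u] by simp
    ultimately have "(2 * u + 4 * u ^ 3) * ?e * exp (- u\<^sup>2) \<le> 110 * exp u * exp (2 * u) * exp (- u\<^sup>2)"
      using u by (intro mult_mono) auto
    also have "\<dots> = 110 * exp (3 * u - u\<^sup>2)" by (simp add: exp_add[symmetric] exp_diff exp_minus divide_inverse)
    \<comment> \<open>The exponent \<open>- u^2\<close> is split in three: one half remains as the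
      wider Gaussian, one quarter gives the gain \<open>- A^2 / 4\<close>, and the last quarter
      absorbs \<open>3 * u\<close> at the price of the constant 9.\<close>
    also have "\<dots> \<le> 110 * exp (9 + (- A\<^sup>2 / 4) + (- u\<^sup>2 / 2))"
    proof -
      have "A\<^sup>2 \<le> u\<^sup>2" using False A by (intro power_mono) auto
      moreover have "0 \<le> (u / 2 - 3)\<^sup>2" by simp
      then have "3 * u \<le> 9 + u\<^sup>2 / 4" by (simp add: power2_eq_square field_simps)
      ultimately have "3 * u - u\<^sup>2 \<le> 9 + (- A\<^sup>2 / 4) + (- u\<^sup>2 / 2)" by simp
      then show ?thesis by simp
    qed
    also have "\<dots> = 110 * exp 9 * exp (- A\<^sup>2 / 4) * exp (- u\<^sup>2 / 2)" by (simp only: exp_add mult.assoc)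
    finally show ?thesis using A by (simp add: add_increasing)
  qed
  have "\<bar>(v \<bullet> w) * (exp z - 1) - (y \<bullet> w) * (exp z - 1 - z)\<bar> * exp (- u\<^sup>2)
    \<le> norm w * sqrt t * ((2 * u + 4 * u ^ 3) * ?e) * exp (- u\<^sup>2)"
    by (intro mult_right_mono 1) simp
  also have "\<dots> = norm w * sqrt t * ((2 * u + 4 * u ^ 3) * ?e * exp (- u\<^sup>2))" by (simp add: mult_ac)
  also have "\<dots> \<le> norm w * sqrt t * ((2 * A + 4 * A ^ 3) * exp (2 * sqrt t * A) * exp (- u\<^sup>2)
       + 110 * exp 9 * exp (- A\<^sup>2 / 4) * exp (- u\<^sup>2 / 2))"
    using t by (intro mult_left_mono 2) auto
  finally show ?thesis unfolding u(2) by simp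
qed

section \<open>The Gaussian Riesz transform and its integrability\<close>

lemma norm_times_gaussian_le:
  fixes t a :: real
  assumes "t > 0" "a \<ge> 0"
  shows "a * exp (- t * a\<^sup>2) \<le> 1 / t + 1"
proof (cases "a \<le> 1")
  case True
  then have "a * exp (- t * a\<^sup>2) \<le> 1 * 1" using assms by (intro mult_mono) auto
  then show ?thesis using assms by (simp add: add_increasing)
next
  case False
  have "t * a \<le> t * a\<^sup>2" using False assms by (simp add: power2_eq_square)
  also have "\<dots> \<le> exp (t * a\<^sup>2)" using exp_ge_add_one_self[of "t * a\<^sup>2"] by linarith
  finally have "a * exp (- t * a\<^sup>2) \<le> 1 / t" using assms by (simp add: exp_minus field_simps)
  then show ?thesis by simp
qed

lemma norm_sq_times_gaussian_le:
  fixes t a :: real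
  assumes "t > 0"
  shows "a\<^sup>2 * exp (- t * a\<^sup>2) \<le> 1 / t"
proof -
  have "t * a\<^sup>2 \<le> exp (t * a\<^sup>2)" using exp_ge_add_one_self[of "t * a\<^sup>2"] by linarith
  then show ?thesis using assms by (simp add: exp_minus field_simps)
qed

text \<open>The normalizing factor \<open>t powr ((s + 1) / 2)\<close> is left out, so that the
  definition does not depend on \<open>s\<close>.\<close>

definition gauss_riesz :: "real \<Rightarrow> 'a::euclidean_space measure \<Rightarrow> 'a \<Rightarrow> 'a" where
  "gauss_riesz t N x = (\<integral>y. exp (- t * (norm (x - y))\<^sup>2) *\<^sub>R (x - y) \<partial>N)"

lemma integrable_gauss_riesz:
  fixes N :: "'a::euclidean_space measure"
  assumes "finite_measure N" and [measurable_cong]: "sets N = sets borel" and "t > 0"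
  shows "integrable N (\<lambda>y. exp (- t * (norm (x - y))\<^sup>2) *\<^sub>R (x - y))"
proof -
  interpret finite_measure N by fact
  show ?thesis
  proof (rule integrable_const_bound[where B="1 / t + 1"])
    show "AE y in N. norm (exp (- t * (norm (x - y))\<^sup>2) *\<^sub>R (x - y)) \<le> 1 / t + 1"
      using norm_times_gaussian_le[OF \<open>t > 0\<close>] by (auto simp: mult.commute)
  qed measurable
qed

lemma integrable_quadratic_gaussian:
  fixes N :: "'a::euclidean_space measure"
  assumes "finite_measure N" and [measurable_cong]: "sets N = sets borel" and "t > 0"
  shows "integrable N (\<lambda>y. (v \<bullet> y) * (y \<bullet> w) * exp (- t * (norm y)\<^sup>2))"
    and "integrable N (\<lambda>y. (norm y)\<^sup>2 * exp (- t * (norm y)\<^sup>2))"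
proof -
  interpret finite_measure N by fact
  show "integrable N (\<lambda>y. (norm y)\<^sup>2 * exp (- t * (norm y)\<^sup>2))"
  proof (rule integrable_const_bound[where B="1 / t"])
    show "AE y in N. norm ((norm y)\<^sup>2 * exp (- t * (norm y)\<^sup>2)) \<le> 1 / t"
      using norm_sq_times_gaussian_le[OF \<open>t > 0\<close>] by auto
  qed measurable
  show "integrable N (\<lambda>y. (v \<bullet> y) * (y \<bullet> w) * exp (- t * (norm y)\<^sup>2))"
  proof (rule integrable_const_bound[where B="norm v * norm w * (1 / t)"])
    show "AE y in N. norm ((v \<bullet> y) * (y \<bullet> w) * exp (- t * (norm y)\<^sup>2)) \<le> norm v * norm w * (1 / t)"
    proof (intro AE_I2)
      fix y
      have "\<bar>v \<bullet> y\<bar> * \<bar>y \<bullet> w\<bar> * exp (- t * (norm y)\<^sup>2)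
          \<le> (norm v * norm y) * (norm y * norm w) * exp (- t * (norm y)\<^sup>2)"
        by (intro mult_mono Cauchy_Schwarz_ineq2) auto
      also have "\<dots> = norm v * norm w * ((norm y)\<^sup>2 * exp (- t * (norm y)\<^sup>2))"
        by (simp add: power2_eq_square mult_ac)
      also have "\<dots> \<le> norm v * norm w * (1 / t)"
        by (intro mult_left_mono norm_sq_times_gaussian_le \<open>t > 0\<close>) auto
      finally show "norm ((v \<bullet> y) * (y \<bullet> w) * exp (- t * (norm y)\<^sup>2)) \<le> norm v * norm w * (1 / t)"
        by (simp add: abs_mult)
    qed
  qed measurable
qed

text \<open>
  The bilinear form of \<open>2 * t * (\<integral>y. (y \<otimes> y) * exp (- t * (norm y)\<^sup>2) \<partial>N) - g t * Id\<close>.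
\<close>
definition second_moment_defect :: "'a::euclidean_space measure \<Rightarrow> real \<Rightarrow> 'a \<Rightarrow> 'a \<Rightarrow> real" where
  "second_moment_defect N t v w =
     2 * t * (\<integral>y. (v \<bullet> y) * (y \<bullet> w) * exp (- t * (norm y)\<^sup>2) \<partial>N)
       - (v \<bullet> w) * (\<integral>y. exp (- t * (norm y)\<^sup>2) \<partial>N)"

lemma linear_second_moment_defect:
  fixes N :: "'a::euclidean_space measure"
  assumes "finite_measure N" "sets N = sets borel" "t > 0"
  shows "linear (\<lambda>v. second_moment_defect N t v w)"
proof -
  note int = integrable_quadratic_gaussian(1)[OF assms]
  have "(\<integral>y. ((a + b) \<bullet> y) * (y \<bullet> w) * exp (- t * (norm y)\<^sup>2) \<partial>N)
      = (\<integral>y. (a \<bullet> y) * (y \<bullet> w) * exp (- t * (norm y)\<^sup>2) \<partial>N)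
       + (\<integral>y. (b \<bullet> y) * (y \<bullet> w) * exp (- t * (norm y)\<^sup>2) \<partial>N)" for a b :: 'a
    by (subst Bochner_Integration.integral_add[OF int int, symmetric]) (simp add: inner_add_left distrib_right)
  moreover have "(\<integral>y. ((r *\<^sub>R a) \<bullet> y) * (y \<bullet> w) * exp (- t * (norm y)\<^sup>2) \<partial>N)
      = r * (\<integral>y. (a \<bullet> y) * (y \<bullet> w) * exp (- t * (norm y)\<^sup>2) \<partial>N)" for r and a :: 'a
    by (subst integral_mult_right_zero[symmetric]) (simp add: mult_ac)
  ultimately show ?thesis
    unfolding second_moment_defect_def
    by (intro linearI) (auto simp: inner_add_left algebra_simps)
qed

text \<open>Multiplying the kernel at \<open>v\<close> by \<open>exp (t * (norm v)^2)\<close> turns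
  it into \<open>exp z\<close> times a Gaussian centred at the origin, with
  \<open>z = 2 * t * (v \<bullet> y)\<close>. Comparing with the kernel at 0 and expanding
  \<open>exp z\<close> to first order leaves exactly the defect, up to the integral of a remainder.
  So the defect is small wherever both transforms are small. The cutoff \<open>A\<close> stays free
  here and is chosen later as a power of \<open>t\<close>.\<close>

lemma second_moment_defect_bound:
  fixes N :: "'a::euclidean_space measure"
  assumes N: "finite_measure N" "sets N = sets borel"
    and t: "0 < t" "t \<le> 1" and v: "norm v \<le> 1" and A: "0 \<le> A"
  shows "\<bar>second_moment_defect N t v w\<bar>
    \<le> norm w * (exp 1 * norm (gauss_riesz t N v) + norm (gauss_riesz t N 0)
        + sqrt t * ((2 * A + 4 * A ^ 3) * exp (2 * sqrt t * A) * (\<integral>y. exp (- t * (norm y)\<^sup>2) \<partial>N)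
        + 110 * exp 9 * exp (- A\<^sup>2 / 4) * (\<integral>y. exp (- (t / 2) * (norm y)\<^sup>2) \<partial>N)))"
proof -
  let ?G = "\<lambda>y. exp (- t * (norm y)\<^sup>2)"
  let ?H = "\<lambda>y. exp (- (t / 2) * (norm y)\<^sup>2)"
  let ?k = "\<lambda>x y. exp (- t * (norm (x - y))\<^sup>2) *\<^sub>R (x - y)"
  define z where "z y = 2 * t * (v \<bullet> y)" for y
  define rem where "rem y = ((v \<bullet> w) * (exp (z y) - 1) - (y \<bullet> w) * (exp (z y) - 1 - z y)) * ?G y" for y
  have iG: "integrable N ?G" and iH: "integrable N ?H"
    using integrable_gaussian[OF N, of t 0] integrable_gaussian[OF N, of "t/2" 0] t by auto
  note iQ = integrable_quadratic_gaussian(1)[OF N t(1), of v w]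
  have ik: "integrable N (\<lambda>y. ?k x y \<bullet> w)" for x
    by (rule integrable_inner_left) (rule integrable_gauss_riesz[OF N t(1)])
  have kw: "(\<integral>y. ?k x y \<bullet> w \<partial>N) = gauss_riesz t N x \<bullet> w" for x
    unfolding gauss_riesz_def by (rule integral_inner_left) (rule integrable_gauss_riesz[OF N t(1)])
  have expand: "exp (z y) * ?G y = exp (t * (norm v)\<^sup>2) * exp (- t * (norm (v - y))\<^sup>2)" for y
  proof -
    have "(norm (v - y))\<^sup>2 = (norm v)\<^sup>2 - 2 * (v \<bullet> y) + (norm y)\<^sup>2"
      by (simp add: power2_norm_eq_inner algebra_simps inner_commute)
    then have "z y + (- t * (norm y)\<^sup>2) = t * (norm v)\<^sup>2 + (- t * (norm (v - y))\<^sup>2)"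
      unfolding z_def by (simp only:) (simp add: algebra_simps)
    then show ?thesis by (metis exp_add)
  qed
  \<comment> \<open>The terms containing \<open>exp (z y)\<close> combine to the kernel at
    \<open>v\<close>, the term \<open>(y \<bullet> w) * ?G y\<close> is minus the kernel at 0, and
    the linear term \<open>z y\<close> produces the second moment.\<close>
  have rem: "rem y = 2 * t * ((v \<bullet> y) * (y \<bullet> w) * ?G y) - (v \<bullet> w) * ?G y
      + exp (t * (norm v)\<^sup>2) * (?k v y \<bullet> w) - ?k 0 y \<bullet> w" for y
  proof -
    have "exp (t * (norm v)\<^sup>2) * (?k v y \<bullet> w) = (exp (z y) * ?G y) * ((v - y) \<bullet> w)"
      unfolding expand by simp
    then show ?thesis unfolding rem_def by (simp add: algebra_simps z_def inner_diff_left)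
  qed
  have irem: "integrable N rem"
    unfolding rem by (intro Bochner_Integration.integrable_add
        Bochner_Integration.integrable_diff integrable_mult_right iQ iG ik)
  have int_rem: "integral\<^sup>L N rem = second_moment_defect N t v w
     + exp (t * (norm v)\<^sup>2) * (gauss_riesz t N v \<bullet> w) - gauss_riesz t N 0 \<bullet> w"
  proof -
    define f where "f y = (v \<bullet> y) * (y \<bullet> w) * ?G y" for y
    define g where "g x y = ?k x y \<bullet> w" for x y
    have [simp]: "integrable N f" "integrable N (g x)" for x
      unfolding f_def[abs_def] g_def[abs_def] by (rule iQ, rule ik)
    have "integral\<^sup>L N rem = (\<integral>y. 2 * t * f y - (v \<bullet> w) * ?G y + exp (t * (norm v)\<^sup>2) * g v y - g 0 y \<partial>N)"
      by (intro Bochner_Integration.integral_cong refl) (simp only: rem f_def g_def)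
    also have "\<dots> = 2 * t * integral\<^sup>L N f - (v \<bullet> w) * integral\<^sup>L N ?G
        + exp (t * (norm v)\<^sup>2) * integral\<^sup>L N (g v) - integral\<^sup>L N (g 0)"
      using iG by simp
    finally show ?thesis by (simp only: second_moment_defect_def f_def[abs_def] g_def[abs_def] kw)
  qed
  have "\<bar>integral\<^sup>L N rem\<bar> \<le> (\<integral>y. \<bar>rem y\<bar> \<partial>N)" by (rule integral_abs_bound)
  also have "\<dots> \<le> (\<integral>y. norm w * sqrt t * ((2 * A + 4 * A ^ 3) * exp (2 * sqrt t * A) * ?G y
        + 110 * exp 9 * exp (- A\<^sup>2 / 4) * ?H y) \<partial>N)"
  proof (rule integral_mono)
    show "integrable N (\<lambda>y. \<bar>rem y\<bar>)" using irem by simp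
    show "integrable N (\<lambda>y. norm w * sqrt t * ((2 * A + 4 * A ^ 3) * exp (2 * sqrt t * A) * ?G y
        + 110 * exp 9 * exp (- A\<^sup>2 / 4) * ?H y))"
      using iG iH by (intro integrable_mult_right Bochner_Integration.integrable_add) auto
    show "\<bar>rem y\<bar> \<le> norm w * sqrt t * ((2 * A + 4 * A ^ 3) * exp (2 * sqrt t * A) * ?G y
        + 110 * exp 9 * exp (- A\<^sup>2 / 4) * ?H y)" for y
      using gaussian_remainder_bound[OF t v A, where w=w and y=y]
      by (simp add: rem_def z_def abs_mult)
  qed
  also have "\<dots> = norm w * (sqrt t * ((2 * A + 4 * A ^ 3) * exp (2 * sqrt t * A) * integral\<^sup>L N ?G
        + 110 * exp 9 * exp (- A\<^sup>2 / 4) * integral\<^sup>L N ?H))"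
    using iG iH by (simp add: mult.assoc)
  finally have 1: "\<bar>integral\<^sup>L N rem\<bar> \<le> \<dots>" .
  have "(norm v)\<^sup>2 \<le> 1" using v by (simp add: power_le_one)
  then have "t * (norm v)\<^sup>2 \<le> 1 * 1" using t by (intro mult_mono) auto
  then have "exp (t * (norm v)\<^sup>2) \<le> exp 1" by simp
  then have "\<bar>exp (t * (norm v)\<^sup>2) * (gauss_riesz t N v \<bullet> w)\<bar>
      \<le> exp 1 * (norm (gauss_riesz t N v) * norm w)"
    unfolding abs_mult by (intro mult_mono Cauchy_Schwarz_ineq2) auto
  moreover have "\<bar>gauss_riesz t N 0 \<bullet> w\<bar> \<le> norm (gauss_riesz t N 0) * norm w"
    by (rule Cauchy_Schwarz_ineq2)
  ultimately have "\<bar>second_moment_defect N t v w\<bar> \<le> \<bar>integral\<^sup>L N rem\<bar>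
      + exp 1 * (norm (gauss_riesz t N v) * norm w) + norm (gauss_riesz t N 0) * norm w"
    using int_rem by linarith
  with 1 show ?thesis by (simp add: algebra_simps)
qed

section \<open>Partial traces and convexity of the Gaussian integral\<close>

lemma Bessel_sum_le:
  fixes B :: "'a::real_inner set"
  assumes B: "finite B" "pairwise orthogonal B" "\<And>e. e \<in> B \<Longrightarrow> norm e = 1"
  shows "(\<Sum>e\<in>B. (y \<bullet> e)\<^sup>2) \<le> (norm y)\<^sup>2"
proof -
  define p where "p = (\<Sum>e\<in>B. (y \<bullet> e) *\<^sub>R e)"
  have pe: "p \<bullet> e = y \<bullet> e" if e: "e \<in> B" for e
  proof -
    have "p \<bullet> e = (\<Sum>e'\<in>B. if e' = e then y \<bullet> e else 0)"
      unfolding p_def inner_sum_left using B(2) B(3)[OF e] e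
      by (intro sum.cong) (auto simp: pairwise_def orthogonal_def norm_eq_1)
    also have "\<dots> = y \<bullet> e" using B(1) e by simp
    finally show ?thesis .
  qed
  have yp: "y \<bullet> p = (\<Sum>e\<in>B. (y \<bullet> e)\<^sup>2)"
    by (simp add: p_def inner_sum_right power2_eq_square)
  have "p \<bullet> p = (\<Sum>e\<in>B. (y \<bullet> e) * (p \<bullet> e))"
    by (subst (2) p_def) (simp add: inner_sum_right)
  also have "\<dots> = (\<Sum>e\<in>B. (y \<bullet> e)\<^sup>2)"
    by (intro sum.cong refl) (simp add: pe power2_eq_square)
  finally have pp: "p \<bullet> p = (\<Sum>e\<in>B. (y \<bullet> e)\<^sup>2)" .
  have "0 \<le> (y - p) \<bullet> (y - p)" by simp
  also have "\<dots> = y \<bullet> y - (\<Sum>e\<in>B. (y \<bullet> e)\<^sup>2)"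
    by (simp add: inner_diff_left inner_diff_right inner_commute[of p y] yp pp)
  finally show ?thesis by (simp add: power2_norm_eq_inner)
qed

text \<open>By Bessel's inequality the partial trace of the second moment over an orthonormal family
  is at most the full trace. Lower bounds for the defect along \<open>d\<close> orthonormal
  directions thus become a lower bound for the full second moment.\<close>

lemma sum_second_moment_defect_le:
  fixes N :: "'a::euclidean_space measure"
  assumes N: "finite_measure N" "sets N = sets borel" and t: "0 < t"
    and B: "finite B" "pairwise orthogonal B" "\<And>e. e \<in> B \<Longrightarrow> norm e = 1"
  shows "(\<Sum>e\<in>B. second_moment_defect N t e e)
    \<le> 2 * t * (\<integral>y. (norm y)\<^sup>2 * exp (- t * (norm y)\<^sup>2) \<partial>N)
       - real (card B) * (\<integral>y. exp (- t * (norm y)\<^sup>2) \<partial>N)"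
proof -
  let ?G = "\<lambda>y. exp (- t * (norm y)\<^sup>2)"
  have "(\<Sum>e\<in>B. (\<integral>y. (e \<bullet> y) * (y \<bullet> e) * ?G y \<partial>N)) = (\<integral>y. (\<Sum>e\<in>B. (e \<bullet> y) * (y \<bullet> e) * ?G y) \<partial>N)"
    by (rule Bochner_Integration.integral_sum[symmetric])
      (rule integrable_quadratic_gaussian(1)[OF N t])
  also have "\<dots> \<le> (\<integral>y. (norm y)\<^sup>2 * ?G y \<partial>N)"
  proof (rule integral_mono)
    show "integrable N (\<lambda>y. \<Sum>e\<in>B. (e \<bullet> y) * (y \<bullet> e) * ?G y)"
      by (intro Bochner_Integration.integrable_sum integrable_quadratic_gaussian(1)[OF N t])
    show "(\<Sum>e\<in>B. (e \<bullet> y) * (y \<bullet> e) * ?G y) \<le> (norm y)\<^sup>2 * ?G y" for y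
      using mult_right_mono[OF Bessel_sum_le[OF B, of y], of "?G y"]
      by (simp add: sum_distrib_right power2_eq_square inner_commute)
  qed (rule integrable_quadratic_gaussian(2)[OF N t])
  finally have "2 * t * (\<Sum>e\<in>B. (\<integral>y. (e \<bullet> y) * (y \<bullet> e) * ?G y \<partial>N))
     \<le> 2 * t * (\<integral>y. (norm y)\<^sup>2 * ?G y \<partial>N)"
    using t by (intro mult_left_mono) auto
  moreover have "(\<Sum>e\<in>B. (e \<bullet> e) * integral\<^sup>L N ?G) = real (card B) * integral\<^sup>L N ?G"
    using B(3) by (simp add: norm_eq_1)
  ultimately show ?thesis
    unfolding second_moment_defect_def sum_subtractf by (simp add: sum_distrib_left)
qed

text \<open>This is the tangent line inequality for the convex function
  \<open>t \<mapsto> \<integral>y. exp (- t * (norm y)^2)\<close>, whose derivative is minus the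
  second moment. It follows pointwise from \<open>1 + x \<le> exp x\<close>, with no differentiation
  under the integral.\<close>

lemma gaussian_integral_convex:
  fixes N :: "'a::euclidean_space measure"
  assumes N: "finite_measure N" "sets N = sets borel" and t: "0 < t" "0 < t'"
  shows "(\<integral>y. exp (- t * (norm y)\<^sup>2) \<partial>N) + (t - t') * (\<integral>y. (norm y)\<^sup>2 * exp (- t * (norm y)\<^sup>2) \<partial>N)
     \<le> (\<integral>y. exp (- t' * (norm y)\<^sup>2) \<partial>N)"
proof -
  have i1: "integrable N (\<lambda>y. exp (- t * (norm y)\<^sup>2))" "integrable N (\<lambda>y. exp (- t' * (norm y)\<^sup>2))"
    using integrable_gaussian[OF N, of t 0] integrable_gaussian[OF N, of t' 0] t by auto
  note i2 = integrable_quadratic_gaussian(2)[OF N t(1)]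
  have "(\<integral>y. exp (- t * (norm y)\<^sup>2) + (t - t') * ((norm y)\<^sup>2 * exp (- t * (norm y)\<^sup>2)) \<partial>N)
     \<le> (\<integral>y. exp (- t' * (norm y)\<^sup>2) \<partial>N)"
  proof (rule integral_mono)
    show "exp (- t * (norm y)\<^sup>2) + (t - t') * ((norm y)\<^sup>2 * exp (- t * (norm y)\<^sup>2))
        \<le> exp (- t' * (norm y)\<^sup>2)" for y :: 'a
    proof -
      have "(1 + (t - t') * (norm y)\<^sup>2) * exp (- t * (norm y)\<^sup>2)
          \<le> exp ((t - t') * (norm y)\<^sup>2) * exp (- t * (norm y)\<^sup>2)"
        by (intro mult_right_mono exp_ge_add_one_self) auto
      also have "\<dots> = exp (- t' * (norm y)\<^sup>2)" by (simp add: exp_add[symmetric] algebra_simps)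
      finally show ?thesis by (simp add: algebra_simps)
    qed
  qed (use i1 i2 in auto)
  then show ?thesis using i1 i2 by simp
qed

section \<open>Growth at large scales\<close>

text \<open>A discrete form of integrating \<open>- 2 * t * g' t \<ge> d' * g t\<close>: the tangent
  line at \<open>t\<close>, evaluated at \<open>l * t\<close>, shows that one step multiplies
  \<open>g\<close> by at least \<open>1 + (1 - l) * d' / 2\<close>.\<close>

lemma gaussian_integral_iterate:
  fixes N :: "'a::euclidean_space measure"
  assumes N: "finite_measure N" "sets N = sets borel"
    and t0: "0 < t0" and l: "0 < l" "l < 1" and d': "0 \<le> d'"
    and step: "\<And>k. k < n \<Longrightarrow> d' * (\<integral>y. exp (- (l ^ k * t0) * (norm y)\<^sup>2) \<partial>N)
       \<le> 2 * (l ^ k * t0) * (\<integral>y. (norm y)\<^sup>2 * exp (- (l ^ k * t0) * (norm y)\<^sup>2) \<partial>N)"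
  shows "(1 + (1 - l) * d' / 2) ^ n * (\<integral>y. exp (- t0 * (norm y)\<^sup>2) \<partial>N)
     \<le> (\<integral>y. exp (- (l ^ n * t0) * (norm y)\<^sup>2) \<partial>N)"
  using step
proof (induction n)
  case 0
  show ?case by simp
next
  case (Suc n)
  define g where "g t = (\<integral>y. exp (- t * (norm y)\<^sup>2) \<partial>N)" for t
  define q where "q t = (\<integral>y. (norm y)\<^sup>2 * exp (- t * (norm y)\<^sup>2) \<partial>N)" for t
  let ?t = "l ^ n * t0"
  have IH: "(1 + (1 - l) * d' / 2) ^ n * g t0 \<le> g ?t"
    unfolding g_def using Suc.IH Suc.prems by (meson less_SucI)
  have st: "d' * g ?t \<le> 2 * ?t * q ?t" unfolding g_def q_def using Suc.prems[of n] by simp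
  have "(1 + (1 - l) * d' / 2) ^ Suc n * g t0 = (1 + (1 - l) * d' / 2) * ((1 + (1 - l) * d' / 2) ^ n * g t0)"
    by simp
  also have "\<dots> \<le> (1 + (1 - l) * d' / 2) * g ?t"
    using l d' by (intro mult_left_mono IH add_nonneg_nonneg) auto
  also have "\<dots> = g ?t + (1 - l) / 2 * (d' * g ?t)" by (simp add: algebra_simps)
  also have "\<dots> \<le> g ?t + (1 - l) / 2 * (2 * ?t * q ?t)"
    using l by (intro add_left_mono mult_left_mono st) auto
  also have "\<dots> = g ?t + (?t - l ^ Suc n * t0) * q ?t" by (simp add: field_simps)
  also have "\<dots> \<le> g (l ^ Suc n * t0)"
    unfolding g_def q_def using t0 l by (intro gaussian_integral_convex[OF N]) auto
  finally show ?case unfolding g_def .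
qed

text \<open>Each expression is a constant times \<open>\<delta> powr (s - j)\<close> with a positive
  exponent, and only finitely many \<open>j\<close> occur. The choice makes the mass near any
  subspace of dimension less than \<open>d\<close> smaller than \<open>c\<close>.\<close>

lemma exists_covering_scale:
  fixes s C c :: real
  assumes "0 < c" and lt: "\<And>j. j < d \<Longrightarrow> real j < s"
  shows "\<exists>\<delta>>0. \<delta> \<le> 1 \<and> (\<forall>j<d. C * (5 / \<delta>) ^ j * ((real j + 3) * \<delta>) powr s < c)"
proof -
  have "eventually (\<lambda>\<delta>. C * (5 / \<delta>) ^ j * ((real j + 3) * \<delta>) powr s < c) (at_right 0)" if "j < d" for j
  proof -
    have "((\<lambda>\<delta>. C * 5 ^ j * (real j + 3) powr s * \<delta> powr (s - real j)) \<longlongrightarrow> 0) (at_right 0)"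
    proof -
      have "((\<lambda>\<delta>::real. \<delta> powr (s - real j)) \<longlongrightarrow> 0) (at_right 0)"
        using lt[OF that] by real_asymp
      from tendsto_mult_right_zero[OF this, of "C * 5 ^ j * (real j + 3) powr s"] show ?thesis .
    qed
    then have "eventually (\<lambda>\<delta>. C * 5 ^ j * (real j + 3) powr s * \<delta> powr (s - real j) < c) (at_right 0)"
      using \<open>0 < c\<close> by (rule order_tendstoD)
    moreover have "eventually (\<lambda>\<delta>::real. 0 < \<delta>) (at_right 0)" by (rule eventually_at_right_less)
    ultimately show ?thesis
    proof eventually_elim
      case (elim \<delta>)
      have "(5 / \<delta>) ^ j * ((real j + 3) * \<delta>) powr s = 5 ^ j * (real j + 3) powr s * \<delta> powr (s - real j)"
        using elim by (simp add: powr_mult power_divide powr_diff powr_realpow)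
      with elim show ?case by (simp add: mult.assoc)
    qed
  qed
  then have "eventually (\<lambda>\<delta>. \<forall>j\<in>{..<d}. C * (5 / \<delta>) ^ j * ((real j + 3) * \<delta>) powr s < c) (at_right 0)"
    by (intro eventually_ball_finite) auto
  moreover have "eventually (\<lambda>\<delta>::real. 0 < \<delta>) (at_right 0)" by (rule eventually_at_right_less)
  moreover have "eventually (\<lambda>\<delta>::real. \<delta> < 1) (at_right 0)" by (rule eventually_at_rightI[of 0 1]) auto
  ultimately have "eventually (\<lambda>\<delta>. 0 < \<delta> \<and> \<delta> \<le> 1 \<and> (\<forall>j<d. C * (5 / \<delta>) ^ j * ((real j + 3) * \<delta>) powr s < c))
      (at_right 0)"
    by eventually_elim auto
  then show ?thesis by (auto dest!: eventually_happens)
qed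

text \<open>The product equals 1 at \<open>l = 1\<close> and has derivative
  \<open>(s - d') / 2 < 0\<close> there, so it exceeds 1 just to the left. For such \<open>l\<close>
  the growth gained in one step beats the factor \<open>l powr (- s / 2)\<close> allowed by the
  upper bound.\<close>

lemma exists_growth_ratio:
  fixes s d' :: real
  assumes "s < d'" "0 < s"
  shows "\<exists>l. 0 < l \<and> l < 1 \<and> 1 < (1 + (1 - l) * d' / 2) * l powr (s / 2)"
proof -
  have "((\<lambda>l. (1 + (1 - l) * d' / 2) * l powr (s / 2)) has_real_derivative (s - d') / 2) (at 1)"
    by (auto intro!: derivative_eq_intros simp: field_simps)
  from DERIV_neg_dec_left[OF this] assms obtain e where e: "e > 0"
    "\<And>h. h > 0 \<Longrightarrow> h < e \<Longrightarrow> 1 < (1 + (1 - (1 - h)) * d' / 2) * (1 - h) powr (s / 2)"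
    by auto
  define h where "h = min (e / 2) (1 / 2)"
  have h: "0 < h" "h < e" "h < 1" using e(1) by (auto simp: h_def)
  show ?thesis by (intro exI[of _ "1 - h"]) (use h e(2)[of h] in auto)
qed

text \<open>The cutoff is \<open>A = t powr (-1/8)\<close>. Then
  \<open>sqrt t * A ^ 3 = t powr (1/8)\<close> and \<open>sqrt t * A\<close> tend to
  \<open>0\<close>, so the first error vanishes, while \<open>exp (- A^2 / 4)\<close> decays faster
  than any power of \<open>t\<close>, so the second one vanishes too.\<close>

lemma exists_error_scale:
  fixes s a b K :: real
  assumes "0 < a" "0 < b"
  shows "\<exists>t0>0. t0 \<le> 1 \<and> (\<forall>t. 0 < t \<longrightarrow> t \<le> t0 \<longrightarrow>
     sqrt t * ((2 * t powr (-1/8) + 4 * (t powr (-1/8)) ^ 3) * exp (2 * sqrt t * t powr (-1/8))) \<le> a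
   \<and> sqrt t * (110 * exp 9 * exp (- (t powr (-1/8))\<^sup>2 / 4) * (K * (t / 2) powr (- s / 2))) \<le> b)"
proof -
  have 1: "((\<lambda>t. sqrt t * ((2 * t powr (-1/8) + 4 * (t powr (-1/8)) ^ 3) * exp (2 * sqrt t * t powr (-1/8)))) \<longlongrightarrow> 0) (at_right 0)"
    by real_asymp
  have 2: "((\<lambda>t. sqrt t * (110 * exp 9 * exp (- (t powr (-1/8))\<^sup>2 / 4) * (K * (t / 2) powr (- s / 2)))) \<longlongrightarrow> 0) (at_right 0)"
  proof -
    have "((\<lambda>t. sqrt t * (exp (- (t powr (-1/8))\<^sup>2 / 4) * (t / 2) powr (- s / 2))) \<longlongrightarrow> 0) (at_right 0)"
      by real_asymp
    from tendsto_mult_right_zero[OF this, of "110 * exp 9 * K"] show ?thesis by (simp add: mult_ac)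
  qed
  have "eventually (\<lambda>t. sqrt t * ((2 * t powr (-1/8) + 4 * (t powr (-1/8)) ^ 3) * exp (2 * sqrt t * t powr (-1/8))) < a
   \<and> sqrt t * (110 * exp 9 * exp (- (t powr (-1/8))\<^sup>2 / 4) * (K * (t / 2) powr (- s / 2))) < b) (at_right 0)"
    by (intro eventually_conj order_tendstoD(2)[OF 1] order_tendstoD(2)[OF 2] assms)
  then obtain e where e: "e > 0" "\<And>t. 0 < t \<Longrightarrow> t < e \<Longrightarrow>
     sqrt t * ((2 * t powr (-1/8) + 4 * (t powr (-1/8)) ^ 3) * exp (2 * sqrt t * t powr (-1/8))) < a
   \<and> sqrt t * (110 * exp 9 * exp (- (t powr (-1/8))\<^sup>2 / 4) * (K * (t / 2) powr (- s / 2))) < b"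
    unfolding eventually_at_right_field by blast
  show ?thesis
    by (intro exI[of _ "min 1 (e / 2)"]) (use e in \<open>auto intro!: less_imp_le\<close>)
qed

text \<open>The point is uniformity: \<open>\<epsilon>\<close> and \<open>\<tau>\<close> are fixed
  before \<open>N\<close> and \<open>F\<close>, so the same values serve all blow-ups of a measure,
  and smallness of the transforms is required only on the compact range \<open>{\<tau>..1}\<close>
  of parameters.\<close>

theorem no_approximately_symmetric_measure:
  fixes s C c :: real
  assumes s: "0 < s" "s \<notin> \<int>" and C: "0 < C" and c: "0 < c"
  shows "\<exists>\<epsilon> \<tau>. 0 < \<epsilon> \<and> 0 < \<tau> \<and> \<tau> \<le> 1 \<and> (\<forall>(N :: 'a::euclidean_space measure) F.
     finite_measure N \<longrightarrow> sets N = sets borel \<longrightarrow> F \<in> sets borel \<longrightarrow> 0 \<in> F \<longrightarrow>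
     (\<forall>x\<in>F. \<forall>r>0. measure N (ball x r) \<le> C * r powr s) \<longrightarrow>
     measure N (ball 0 1 - F) \<le> \<epsilon> \<longrightarrow>
     (\<forall>x\<in>F. norm x < 1 \<longrightarrow> (\<forall>t\<in>{\<tau>..1}. norm (gauss_riesz t N x) \<le> \<epsilon>)) \<longrightarrow>
     \<not> c \<le> measure N (ball 0 1))"
proof -
  define d where "d = Suc (nat \<lfloor>s\<rfloor>)"
  have d: "s < real d" using s by (simp add: d_def) linarith
  \<comment> \<open>Non-integrality enters here: the largest integer below \<open>d\<close> is the
    floor of \<open>s\<close>, and it must be strictly less than \<open>s\<close> for the covering
    bound to become small.\<close>
  have jd: "real j < s" if "j < d" for j
  proof -
    have "of_int \<lfloor>s\<rfloor> \<noteq> s" using s(2) by (metis Ints_of_int)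
    then have "of_int \<lfloor>s\<rfloor> < s" using of_int_floor_le[of s] by linarith
    moreover have "real j \<le> of_int \<lfloor>s\<rfloor>" using that s(1) by (simp add: d_def) linarith
    ultimately show ?thesis by linarith
  qed
  \<comment> \<open>Of the gap between \<open>s\<close> and \<open>d\<close>, the upper half pays
    for the errors in the trace and the lower half drives the growth.\<close>
  define d' where "d' = (real d + s) / 2"
  have d': "s < d'" "d' < real d" using d by (auto simp: d'_def)
  obtain \<delta> where \<delta>: "\<delta> > 0" "\<delta> \<le> 1"
    "\<And>j. j < d \<Longrightarrow> C * (5 / \<delta>) ^ j * ((real j + 3) * \<delta>) powr s < c / 2"
    using exists_covering_scale[of "c / 2" d s C] c jd by auto
  define L where "L = real d * gram_schmidt_const \<delta> d + 1"
  have L: "L > 0" using gram_schmidt_const_nonneg[OF \<delta>(1), of d] by (simp add: L_def add_nonneg_pos)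
  define K where "K = C * (\<Sum>k. exp (- (real k)\<^sup>2) * (real k + 1) powr s)"
  define c0 where "c0 = exp (-1) * c"
  have c0: "c0 > 0" using c by (simp add: c0_def)
  \<comment> \<open>The error per direction will be \<open>E t \<le> 3 * \<kappa> * g t\<close>;
    after the loss \<open>L\<close> from orthonormalization this is exactly the allowed
    \<open>(d - d') * g t\<close>.\<close>
  define \<kappa> where "\<kappa> = (real d - d') / L / 3"
  have \<kappa>: "\<kappa> > 0" using d' L by (simp add: \<kappa>_def)
  obtain t0 where t0: "0 < t0" "t0 \<le> 1"
    and e1: "\<And>t. 0 < t \<Longrightarrow> t \<le> t0 \<Longrightarrow>
      sqrt t * ((2 * t powr (-1/8) + 4 * (t powr (-1/8)) ^ 3) * exp (2 * sqrt t * t powr (-1/8))) \<le> \<kappa>"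
    and e2: "\<And>t. 0 < t \<Longrightarrow> t \<le> t0 \<Longrightarrow>
      sqrt t * (110 * exp 9 * exp (- (t powr (-1/8))\<^sup>2 / 4) * (K * (t / 2) powr (- s / 2))) \<le> \<kappa> * c0"
    using exists_error_scale[of \<kappa> "\<kappa> * c0" K s] \<kappa> c0 by auto
  obtain l where l: "0 < l" "l < 1" "1 < (1 + (1 - l) * d' / 2) * l powr (s / 2)"
    using exists_growth_ratio[OF d'(1) s(1)] by auto
  define \<rho> where "\<rho> = (1 + (1 - l) * d' / 2) * l powr (s / 2)"
  \<comment> \<open>Growth over \<open>n\<close> steps together with the upper bound for
    \<open>g\<close> forces \<open>\<rho> ^ n * c0 * t0 powr (s / 2) \<le> K\<close>; this
    \<open>n\<close> is chosen to violate it.\<close>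
  obtain n where n: "K / (c0 * t0 powr (s / 2)) < \<rho> ^ n"
    using real_arch_pow[of \<rho>] l(3) unfolding \<rho>_def by blast
  define \<tau> where "\<tau> = l ^ n * t0"
  have \<tau>: "0 < \<tau>" "\<tau> \<le> 1"
    using t0 l by (auto simp: \<tau>_def intro!: mult_le_one power_le_one)
  \<comment> \<open>The first bound leaves mass at least \<open>c / 2\<close> in
    \<open>F \<inter> ball 0 1\<close>; the second keeps the contribution of the two Gaussian
    transforms below \<open>\<kappa> * c0\<close>.\<close>
  define \<epsilon> where "\<epsilon> = min (c / 2) (\<kappa> * c0 / (exp 1 + 1))"
  have ex1: "exp 1 + 1 > (0::real)" by (intro add_pos_pos) auto
  have \<epsilon>: "\<epsilon> > 0" "\<epsilon> \<le> c / 2" "\<epsilon> * (exp 1 + 1) \<le> \<kappa> * c0"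
  proof -
    show "\<epsilon> > 0" using c \<kappa> c0 ex1 by (simp add: \<epsilon>_def)
    show "\<epsilon> \<le> c / 2" unfolding \<epsilon>_def by (rule min.cobounded1)
    have "\<epsilon> \<le> \<kappa> * c0 / (exp 1 + 1)" by (simp add: \<epsilon>_def)
    then show "\<epsilon> * (exp 1 + 1) \<le> \<kappa> * c0" using ex1 by (simp only: pos_le_divide_eq)
  qed
  show ?thesis
  proof (rule exI[of _ \<epsilon>], rule exI[of _ \<tau>], intro conjI allI impI notI \<epsilon>(1) \<tau>)
    fix N :: "'a measure" and F :: "'a set"
    assume N: "finite_measure N" "sets N = sets borel" and F: "F \<in> sets borel" "0 \<in> F"
      and gr: "\<forall>x\<in>F. \<forall>r>0. measure N (ball x r) \<le> C * r powr s"
      and dens: "measure N (ball 0 1 - F) \<le> \<epsilon>"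
      and sym: "\<forall>x\<in>F. norm x < 1 \<longrightarrow> (\<forall>t\<in>{\<tau>..1}. norm (gauss_riesz t N x) \<le> \<epsilon>)"
      and mass: "c \<le> measure N (ball 0 1)"
    interpret finite_measure N by fact
    define X where "X = F \<inter> ball 0 1"
    define g where "g t = (\<integral>y. exp (- t * (norm y)\<^sup>2) \<partial>N)" for t
    have X: "X \<in> sets borel" "\<And>v. v \<in> X \<Longrightarrow> norm v < 1" using F by (auto simp: X_def)
    have massX: "c / 2 \<le> measure N X"
    proof -
      have "ball 0 1 = X \<union> (ball 0 1 - F)" by (auto simp: X_def)
      then have "measure N (ball 0 1) \<le> measure N X + measure N (ball 0 1 - F)"
        using measure_Un_le[of X N "ball 0 1 - F"] X F by (simp add: N(2))
      then show ?thesis using mass dens \<epsilon>(2) by linarith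
    qed
    \<comment> \<open>Otherwise all of \<open>X\<close> would lie within \<open>\<delta>\<close> of
      the span of \<open>B\<close>, and the covering bound would contradict its mass
      \<open>c / 2\<close>.\<close>
    have far: "\<exists>v\<in>X. norm (v - (\<Sum>e\<in>B. (v \<bullet> e) *\<^sub>R e)) \<ge> \<delta>"
      if B: "finite B" "pairwise orthogonal B" "\<And>e. e \<in> B \<Longrightarrow> norm e = 1" "card B < d" for B
    proof (rule ccontr)
      assume "\<not> ?thesis"
      then have near: "norm (v - (\<Sum>e\<in>B. (v \<bullet> e) *\<^sub>R e)) < \<delta>" if "v \<in> X" for v
        using that by force
      have "measure N X \<le> C * (5 / \<delta>) ^ card B * ((real (card B) + 3) * \<delta>) powr s"
        by (rule measure_near_subspace_le[OF N _ B(1-3) X \<delta>(1,2) near]) (use gr C in \<open>auto simp: X_def\<close>)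
      with massX \<delta>(3)[OF B(4)] show False by simp
    qed
    \<comment> \<open>On the unit ball the Gaussian is at least \<open>exp (-1)\<close> when
      \<open>t \<le> 1\<close>, whence the constant \<open>c0\<close>.\<close>
    have g_lower: "c0 \<le> g t" if t: "0 < t" "t \<le> 1" for t
    proof -
      have "c0 \<le> exp (-1) * measure N (ball 0 1)" using mass by (simp add: c0_def)
      also have "\<dots> = (\<integral>y. exp (-1) * indicator (ball 0 1) y \<partial>N)"
        by (simp add: N(2))
      also have "\<dots> \<le> g t" unfolding g_def
      proof (rule integral_mono)
        show "integrable N (\<lambda>y. exp (-1) * indicator (ball 0 1) y :: real)"
          by (intro integrable_mult_right integrable_real_indicator) (auto simp: N(2) emeasure_eq_measure)
        show "integrable N (\<lambda>y. exp (- t * (norm y)\<^sup>2))"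
          using integrable_gaussian[OF N, of t 0] t by simp
        show "exp (-1) * indicator (ball 0 1) y \<le> exp (- t * (norm y)\<^sup>2)" for y :: 'a
        proof (cases "y \<in> ball 0 1")
          case True
          then have "(norm y)\<^sup>2 \<le> 1" by (simp add: power_le_one)
          then have "t * (norm y)\<^sup>2 \<le> 1 * 1" using t by (intro mult_mono) auto
          then show ?thesis using True by simp
        qed simp
      qed
      finally show ?thesis .
    qed
    have g_upper: "g t \<le> K * t powr (- s / 2)" if "0 < t" for t
      unfolding g_def K_def using gr F(2) that by (intro gaussian_integral_growth N) auto
    \<comment> \<open>One \<open>\<kappa> * c0\<close> accounts for the transforms at
      \<open>v\<close> and 0, the other for the widened Gaussian tail, and
      \<open>\<kappa> * g t\<close> for the remainder inside the cutoff.\<close>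
    define E where "E t = \<kappa> * (2 * c0 + g t)" for t
    have small: "\<bar>second_moment_defect N t v w\<bar> \<le> norm w * E t"
      if t: "t \<in> {\<tau>..t0}" and v: "v \<in> X" for t v w
    proof -
      have t': "0 < t" "t \<le> t0" "t \<le> 1" "t \<in> {\<tau>..1}" using t \<tau> t0 by auto
      let ?A = "t powr (-1/8)"
      have "\<bar>second_moment_defect N t v w\<bar>
        \<le> norm w * (exp 1 * norm (gauss_riesz t N v) + norm (gauss_riesz t N 0)
        + sqrt t * ((2 * ?A + 4 * ?A ^ 3) * exp (2 * sqrt t * ?A) * g t
        + 110 * exp 9 * exp (- ?A\<^sup>2 / 4) * g (t / 2)))"
        unfolding g_def using X(2)[OF v] t' by (intro second_moment_defect_bound[OF N]) auto
      also have "\<dots> \<le> norm w * E t"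
      proof (rule mult_left_mono)
        have "norm (gauss_riesz t N v) \<le> \<epsilon>" "norm (gauss_riesz t N 0) \<le> \<epsilon>"
          using sym v F(2) t'(4) by (auto simp: X_def)
        then have "exp 1 * norm (gauss_riesz t N v) + norm (gauss_riesz t N 0) \<le> exp 1 * \<epsilon> + \<epsilon>"
          by (intro add_mono mult_left_mono) auto
        also have "\<dots> \<le> \<kappa> * c0" using \<epsilon>(3) by (simp add: algebra_simps)
        finally have a: "exp 1 * norm (gauss_riesz t N v) + norm (gauss_riesz t N 0) \<le> \<kappa> * c0" .
        let ?U = "(2 * ?A + 4 * ?A ^ 3) * exp (2 * sqrt t * ?A)"
        let ?V = "110 * exp 9 * exp (- ?A\<^sup>2 / 4)"
        have "(sqrt t * ?U) * g t \<le> \<kappa> * g t"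
          using g_lower[OF t'(1,3)] c0 by (intro mult_right_mono e1 t') auto
        moreover have "sqrt t * (?V * g (t / 2)) \<le> sqrt t * (?V * (K * (t / 2) powr (- s / 2)))"
          using t' by (intro mult_left_mono g_upper) auto
        moreover note e2[OF t'(1,2)]
        moreover have "sqrt t * (?U * g t + ?V * g (t / 2)) = (sqrt t * ?U) * g t + sqrt t * (?V * g (t / 2))"
          by (simp only: distrib_left mult.assoc)
        moreover have "E t = 2 * (\<kappa> * c0) + \<kappa> * g t" by (simp add: E_def distrib_left)
        ultimately show "exp 1 * norm (gauss_riesz t N v) + norm (gauss_riesz t N 0)
          + sqrt t * (?U * g t + ?V * g (t / 2)) \<le> E t"
          using a by linarith
      qed simp
      finally show ?thesis .
    qed
    \<comment> \<open>The choice of points of \<open>X\<close> does not involve \<open>t\<close>, so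
      one orthonormal family works for the whole range of parameters.\<close>
    have "\<exists>B. finite B \<and> card B = d \<and> pairwise orthogonal B \<and> (\<forall>e\<in>B. norm e = 1)
       \<and> (\<forall>t\<in>{\<tau>..t0}. \<forall>e\<in>B. \<forall>w. \<bar>second_moment_defect N t e w\<bar> \<le> gram_schmidt_const \<delta> d * (norm w * E t))"
      by (rule gram_schmidt_approx[OF \<delta>(1) _ X(2) small far])
        (use \<tau> in \<open>auto intro!: linear_second_moment_defect N\<close>)
    then obtain B where B: "finite B" "card B = d" "pairwise orthogonal B" "\<And>e. e \<in> B \<Longrightarrow> norm e = 1"
      and smallB: "\<And>t e w. t \<in> {\<tau>..t0} \<Longrightarrow> e \<in> B \<Longrightarrow>
         \<bar>second_moment_defect N t e w\<bar> \<le> gram_schmidt_const \<delta> d * (norm w * E t)"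
      by auto
    have trace: "d' * g t \<le> 2 * t * (\<integral>y. (norm y)\<^sup>2 * exp (- t * (norm y)\<^sup>2) \<partial>N)"
      if t: "t \<in> {\<tau>..t0}" for t
    proof -
      have t': "0 < t" "t \<le> 1" using t \<tau> t0 by auto
      have gt: "c0 \<le> g t" by (rule g_lower[OF t'])
      then have E0: "0 \<le> E t" using \<kappa> c0 by (simp add: E_def)
      have "(\<Sum>e\<in>B. - (gram_schmidt_const \<delta> d * E t)) \<le> (\<Sum>e\<in>B. second_moment_defect N t e e)"
      proof (rule sum_mono)
        fix e assume "e \<in> B"
        then show "- (gram_schmidt_const \<delta> d * E t) \<le> second_moment_defect N t e e"
          using smallB[OF t, of e e] B(4) by simp
      qed
      also have "\<dots> \<le> 2 * t * (\<integral>y. (norm y)\<^sup>2 * exp (- t * (norm y)\<^sup>2) \<partial>N) - real d * g t"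
        unfolding g_def B(2)[symmetric] by (rule sum_second_moment_defect_le[OF N t'(1) B(1,3,4)])
      finally have "real d * g t - real d * gram_schmidt_const \<delta> d * E t
          \<le> 2 * t * (\<integral>y. (norm y)\<^sup>2 * exp (- t * (norm y)\<^sup>2) \<partial>N)"
        using B(2) by simp
      moreover have "real d * gram_schmidt_const \<delta> d * E t \<le> (real d - d') * g t"
      proof -
        have "real d * gram_schmidt_const \<delta> d * E t \<le> L * E t"
          using E0 by (intro mult_right_mono) (auto simp: L_def)
        also have "\<dots> \<le> L * (\<kappa> * (3 * g t))"
          unfolding E_def using L \<kappa> gt by (intro mult_left_mono) auto
        also have "\<dots> = (real d - d') * g t" using L by (simp add: \<kappa>_def)
        finally show ?thesis .
      qed
      ultimately show ?thesis by (simp add: algebra_simps)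
    qed
    have "(1 + (1 - l) * d' / 2) ^ n * g t0 \<le> g \<tau>"
      unfolding g_def \<tau>_def
    proof (rule gaussian_integral_iterate[OF N t0(1) l(1,2)])
      show "0 \<le> d'" using d' s by simp
      fix k assume k: "k < n"
      have "l ^ n \<le> l ^ k" "l ^ k \<le> 1" using k l by (auto intro: power_decreasing power_le_one)
      then have "l ^ n * t0 \<le> l ^ k * t0" "l ^ k * t0 \<le> 1 * t0"
        using t0 by (auto intro!: mult_right_mono simp del: mult_1)
      then have "l ^ k * t0 \<in> {\<tau>..t0}" by (simp add: \<tau>_def)
      from trace[OF this] show "d' * (\<integral>y. exp (- (l ^ k * t0) * (norm y)\<^sup>2) \<partial>N)
         \<le> 2 * (l ^ k * t0) * (\<integral>y. (norm y)\<^sup>2 * exp (- (l ^ k * t0) * (norm y)\<^sup>2) \<partial>N)"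
        unfolding g_def .
    qed
    also have "\<dots> \<le> K * \<tau> powr (- s / 2)" by (rule g_upper[OF \<tau>(1)])
    \<comment> \<open>Multiplying by \<open>\<tau> powr (s / 2)\<close> cancels the power on the
      right and turns the growth factor into \<open>\<rho> ^ n\<close>.\<close>
    finally have "(1 + (1 - l) * d' / 2) ^ n * g t0 * \<tau> powr (s / 2) \<le> K * \<tau> powr (- s / 2) * \<tau> powr (s / 2)"
      by (intro mult_right_mono) auto
    also have "\<dots> = K" using \<tau> by (simp add: mult.assoc powr_add[symmetric])
    finally have up: "(1 + (1 - l) * d' / 2) ^ n * g t0 * \<tau> powr (s / 2) \<le> K" .
    have "\<tau> powr (s / 2) = (l powr (s / 2)) ^ n * t0 powr (s / 2)"
      unfolding \<tau>_def using l t0 by (simp add: powr_mult powr_power powr_realpow[symmetric] powr_powr mult.commute)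
    then have "\<rho> ^ n * (g t0 * t0 powr (s / 2)) \<le> K"
      using up by (simp add: \<rho>_def power_mult_distrib mult_ac)
    moreover have "\<rho> ^ n * (c0 * t0 powr (s / 2)) \<le> \<rho> ^ n * (g t0 * t0 powr (s / 2))"
      using l(3) t0 by (intro mult_left_mono mult_right_mono g_lower) (auto simp: \<rho>_def intro!: zero_le_power)
    moreover have "K < \<rho> ^ n * (c0 * t0 powr (s / 2))"
      using n c0 t0 by (simp add: pos_divide_less_eq)
    ultimately show False by linarith
  qed
qed

section \<open>From principal values to Gaussian Riesz transforms\<close>

text \<open>
  The derivative of \<open>u powr (s + 1) * exp (- u\<^sup>2)\<close>: integrating truncated kernels against it gives the
  Gaussian kernel, and its total integral is \<open>0\<close>.
\<close>
definition layer_density :: "real \<Rightarrow> real \<Rightarrow> real" where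
  "layer_density s e = indicator {0<..} e * (((s + 1) * e powr s - 2 * e powr (s + 2)) * exp (- e\<^sup>2))"

lemma measurable_layer_density [measurable]: "layer_density s \<in> borel_measurable borel"
  unfolding layer_density_def[abs_def] by measurable

lemma integrable_even_moment:
  "integrable lborel (\<lambda>e::real. indicator {0..} e * (e ^ (2 * k) * exp (- e\<^sup>2)))"
proof -
  have "integrable lborel (\<lambda>x::real. indicator {0..} x *\<^sub>R (exp (-x\<^sup>2)*x^(2 * k)))"
    using gaussian_moment_even_pos[of k] by (simp add: has_bochner_integral_iff)
  then show ?thesis by (simp add: mult.commute)
qed

text \<open>With \<open>s \<le> 2 * k\<close> the factor \<open>1 + e ^ (2 * k)\<close> dominates
  \<open>e powr s\<close>, and its summand 1 also covers the density after multiplication by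
  \<open>e powr (- s)\<close>, the size of the truncated kernel. All powers are even, so the
  integral is a combination of even Gaussian moments.\<close>

definition layer_majorant :: "nat \<Rightarrow> real \<Rightarrow> real \<Rightarrow> real" where
  "layer_majorant k s e = indicator {0..} e * ((1 + e ^ (2 * k)) * ((s + 1) + 2 * e\<^sup>2) * exp (- e\<^sup>2))"

lemma integrable_layer_majorant: "integrable lborel (layer_majorant k s)"
proof -
  let ?m = "\<lambda>j e. indicator {0..} e * (e ^ (2 * j) * exp (- e\<^sup>2)) :: real"
  have eq: "layer_majorant k s = (\<lambda>e. (s + 1) * ?m 0 e + 2 * ?m 1 e + (s + 1) * ?m k e + 2 * ?m (Suc k) e)"
    by (intro ext) (simp add: layer_majorant_def algebra_simps power2_eq_square)
  show ?thesis unfolding eq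
    by (intro Bochner_Integration.integrable_add integrable_mult_right integrable_even_moment)
qed

lemma layer_density_le:
  assumes s: "0 < s" "s \<le> 2 * real k"
  shows "\<bar>layer_density s e\<bar> \<le> layer_majorant k s e"
    and "\<bar>layer_density s e\<bar> * e powr (- s) \<le> layer_majorant k s e"
proof -
  have "\<bar>layer_density s e\<bar> \<le> layer_majorant k s e \<and> \<bar>layer_density s e\<bar> * e powr (- s) \<le> layer_majorant k s e"
  proof (cases "e > 0")
    case True
    let ?h = "((s + 1) + 2 * e\<^sup>2) * exp (- e\<^sup>2)"
    have h: "0 \<le> ?h" using s by (intro mult_nonneg_nonneg) auto
    have "e powr (s + 2) = e powr s * e\<^sup>2" using True by (simp add: powr_add)
    then have eq: "layer_density s e = e powr s * (((s + 1) - 2 * e\<^sup>2) * exp (- e\<^sup>2))"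
      using True by (simp add: layer_density_def algebra_simps)
    have "\<bar>(s + 1) - 2 * e\<^sup>2\<bar> \<le> (s + 1) + 2 * e\<^sup>2" using s zero_le_power2[of e] by linarith
    then have q: "\<bar>((s + 1) - 2 * e\<^sup>2) * exp (- e\<^sup>2)\<bar> \<le> ?h" by (simp add: abs_mult)
    have "\<bar>layer_density s e\<bar> = e powr s * \<bar>((s + 1) - 2 * e\<^sup>2) * exp (- e\<^sup>2)\<bar>"
      unfolding eq abs_mult[of "e powr s"] by simp
    also have "\<dots> \<le> e powr s * ?h" by (intro mult_left_mono q) simp
    finally have 1: "\<bar>layer_density s e\<bar> \<le> e powr s * ?h" .
    have "e powr s \<le> 1 + e ^ (2 * k)"
    proof (cases "e \<le> 1")
      case True
      then have "e powr s \<le> 1" using \<open>e > 0\<close> s by (simp add: powr_le1)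
      then show ?thesis using \<open>e > 0\<close> by (simp add: add_increasing2)
    next
      case False
      then have "e powr s \<le> e powr (real (2 * k))" using s by (intro powr_mono) auto
      then show ?thesis using \<open>e > 0\<close> by (subst (asm) powr_realpow) auto
    qed
    then have "e powr s * ?h \<le> (1 + e ^ (2 * k)) * ?h" using h by (rule mult_right_mono)
    also have "\<dots> = layer_majorant k s e" using True by (simp add: layer_majorant_def)
    finally have a: "e powr s * ?h \<le> layer_majorant k s e" .
    have "\<bar>layer_density s e\<bar> * e powr (- s) \<le> e powr s * ?h * e powr (- s)"
      using 1 by (rule mult_right_mono) simp
    also have "\<dots> = ?h" using True by (simp add: powr_minus field_simps)
    also have "\<dots> \<le> (1 + e ^ (2 * k)) * ?h" using h True mult_right_mono[of 1 "1 + e ^ (2 * k)" ?h] by simp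
    also have "\<dots> = layer_majorant k s e" using True by (simp add: layer_majorant_def)
    finally show ?thesis using 1 a by linarith
  next
    case False
    have "0 \<le> layer_majorant k s e" using s by (simp add: layer_majorant_def)
    then show ?thesis using False by (simp add: layer_density_def)
  qed
  then show "\<bar>layer_density s e\<bar> \<le> layer_majorant k s e"
    and "\<bar>layer_density s e\<bar> * e powr (- s) \<le> layer_majorant k s e" by auto
qed

lemma integrable_layer_density:
  assumes "0 < s" shows "integrable lborel (layer_density s)"
proof (rule Bochner_Integration.integrable_bound[OF integrable_layer_majorant])
  show "AE e in lborel. norm (layer_density s e) \<le> norm (layer_majorant (nat \<lceil>s\<rceil>) s e)"
  proof (intro AE_I2)
    fix e
    have "s \<le> 2 * real (nat \<lceil>s\<rceil>)" using assms by linarith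
    from layer_density_le(1)[OF assms this, of e]
    show "norm (layer_density s e) \<le> norm (layer_majorant (nat \<lceil>s\<rceil>) s e)" by simp
  qed
qed simp

lemma layer_density_integral:
  assumes "0 < s" "0 \<le> u"
  shows "(\<integral>e. layer_density s e * indicator {..<u} e \<partial>lborel) = u powr (s + 1) * exp (- u\<^sup>2)"
proof -
  let ?F = "\<lambda>u::real. u powr (s + 1) * exp (- u\<^sup>2)"
  let ?f = "\<lambda>e. ((s + 1) * e powr s - 2 * e powr (s + 2)) * exp (- e\<^sup>2)"
  have "(?f has_integral (?F u - ?F 0)) {0..u}"
  proof (rule fundamental_theorem_of_calculus_interior[OF assms(2)])
    show "continuous_on {0..u} ?F"
      using assms by (intro continuous_on_mult continuous_on_powr' continuous_intros) auto
    fix x assume "x \<in> {0<..<u}"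
    then have x: "x > 0" by simp
    have "x powr (s + 2) = x powr (s + 1) * x" using x by (simp flip: powr_mult_base add: powr_add power2_eq_square)
    then have "(?F has_real_derivative ?f x) (at x)"
      using x by (auto intro!: derivative_eq_intros simp: algebra_simps)
    then show "(?F has_vector_derivative ?f x) (at x)"
      by (simp add: has_real_derivative_iff_has_vector_derivative)
  qed
  then have 1: "(?f has_integral ?F u) {0..u}" using assms by simp
  have "(?f has_integral ?F u) {0<..<u}"
    using 1 by (simp only: has_integral_Icc_iff_Ioo)
  then have "((\<lambda>e. if e \<in> {0<..<u} then ?f e else 0) has_integral ?F u) UNIV"
    by (simp only: has_integral_restrict_UNIV)
  moreover have "(\<lambda>e. if e \<in> {0<..<u} then ?f e else 0) = (\<lambda>e. layer_density s e * indicator {..<u} e)"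
    by (auto simp: layer_density_def fun_eq_iff indicator_def)
  ultimately have 2: "((\<lambda>e. layer_density s e * indicator {..<u} e) has_integral ?F u) UNIV" by simp
  have "integrable lborel (\<lambda>e. layer_density s e * indicator {..<u} e)"
    by (rule Bochner_Integration.integrable_bound[OF integrable_layer_density[OF assms(1)]])
      (auto simp: indicator_def)
  from has_integral_unique[OF has_integral_integral_lborel[OF this] 2] show ?thesis .
qed

text \<open>The primitive \<open>u powr (s + 1) * exp (- u^2)\<close> vanishes at infinity. This
  cancellation later removes the principal value, whatever its value is.\<close>

lemma layer_density_integral_UNIV:
  assumes "0 < s"
  shows "(\<integral>e. layer_density s e \<partial>lborel) = 0"
proof -
  have "((\<lambda>u. \<integral>e. layer_density s e * indicator {..<u} e \<partial>lborel) \<longlongrightarrow> (\<integral>e. layer_density s e \<partial>lborel)) at_top"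
  proof (rule integral_dominated_convergence_at_top)
    show "integrable lborel (\<lambda>e. \<bar>layer_density s e\<bar>)" using integrable_layer_density[OF assms] by simp
    show "AE e in lborel. ((\<lambda>u. layer_density s e * indicator {..<u} e) \<longlongrightarrow> layer_density s e) at_top"
    proof (intro AE_I2 tendsto_eventually)
      fix e :: real
      show "\<forall>\<^sub>F u in at_top. layer_density s e * indicator {..<u} e = layer_density s e"
        using eventually_gt_at_top[of e] by eventually_elim simp
    qed
    show "\<forall>\<^sub>F u in at_top. AE e in lborel. norm (layer_density s e * indicator {..<u} e) \<le> \<bar>layer_density s e\<bar>"
      by (intro always_eventually allI AE_I2) (auto simp: indicator_def)
  qed measurable
  moreover have "((\<lambda>u. \<integral>e. layer_density s e * indicator {..<u} e \<partial>lborel) \<longlongrightarrow> 0) at_top"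
  proof (rule Lim_transform_eventually)
    show "((\<lambda>u. u powr (s + 1) * exp (- u\<^sup>2)) \<longlongrightarrow> 0) at_top" by real_asymp
    show "\<forall>\<^sub>F u in at_top. u powr (s + 1) * exp (- u\<^sup>2) = (\<integral>e. layer_density s e * indicator {..<u} e \<partial>lborel)"
      using eventually_ge_at_top[of 0] by eventually_elim (simp add: layer_density_integral[OF assms])
  qed
  ultimately show ?thesis using tendsto_unique[OF trivial_limit_at_top_linorder] by blast
qed

section \<open>The layer formula for a fixed measure and point\<close>

context
  fixes s :: real and M :: "(real ^ 'm) measure" and x :: "real ^ 'm"
  assumes fM: "finite_measure M" and sM [measurable_cong]: "sets M = sets borel" and s: "0 < s"
begin

interpretation finite_measure M by (rule fM)

text \<open>The truncation is moved into the integrand so that \<open>e\<close> can serve as a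
  second variable of integration.\<close>

definition "riesz_integrand e y = (if e < norm (x - y) then (x - y) /\<^sub>R (norm (x - y) powr (s + 1)) else 0)"

lemma truncated_riesz_eq: "truncated_riesz s M e x = (\<integral>y. riesz_integrand e y \<partial>M)"
  unfolding truncated_riesz_def set_lebesgue_integral_def riesz_integrand_def
  by (intro Bochner_Integration.integral_cong refl) (auto simp: indicator_def)

lemma measurable_riesz_integrand [measurable]:
  "(\<lambda>(y, e). riesz_integrand e y) \<in> borel_measurable (M \<Otimes>\<^sub>M borel)"
  unfolding riesz_integrand_def by measurable

lemma norm_riesz_integrand_le:
  assumes "0 < e"
  shows "norm (riesz_integrand e y) \<le> e powr (- s)"
proof (cases "e < norm (x - y)")
  case True
  then have "norm (riesz_integrand e y) = inverse (norm (x - y) powr (s + 1)) * norm (x - y)"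
    by (simp add: riesz_integrand_def)
  also have "\<dots> = norm (x - y) powr (- s)"
  proof -
    have "0 < norm (x - y)" using True assms by linarith
    then show ?thesis by (simp add: powr_add powr_minus)
  qed
  also have "\<dots> \<le> e powr (- s)" using True assms s by (intro powr_mono2') auto
  finally show ?thesis .
qed (use assms in \<open>simp add: riesz_integrand_def\<close>)

text \<open>Near 0 the limit bounds the transform; for \<open>e \<ge> b\<close> the kernel is at
  most \<open>b powr (- s)\<close> and the measure is finite. This supplies the dominating function
  for the passage to the limit.\<close>

lemma truncated_riesz_bounded:
  assumes "((\<lambda>\<epsilon>. truncated_riesz s M \<epsilon> x) \<longlongrightarrow> l) (at_right 0)"
  shows "\<exists>B. \<forall>e>0. norm (truncated_riesz s M e x) \<le> B"
proof -
  have "eventually (\<lambda>e. dist (truncated_riesz s M e x) l < 1) (at_right 0)"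
    using assms by (rule tendstoD) simp
  then obtain b where b: "b > 0" "\<And>e. 0 < e \<Longrightarrow> e < b \<Longrightarrow> dist (truncated_riesz s M e x) l < 1"
    unfolding eventually_at_right_field by blast
  show ?thesis
  proof (intro exI allI impI)
    fix e :: real assume e: "e > 0"
    show "norm (truncated_riesz s M e x) \<le> max (norm l + 1) (b powr (- s) * measure M (space M))"
    proof (cases "e < b")
      case True
      then have "norm (truncated_riesz s M e x) \<le> norm l + 1"
        using b(2)[OF e] norm_triangle_ineq2[of "truncated_riesz s M e x" l] by (simp add: dist_norm)
      then show ?thesis by simp
    next
      case False
      have bound: "norm (riesz_integrand e y) \<le> b powr (- s)" for y
        using norm_riesz_integrand_le[OF e, of y] powr_mono2'[of "-s" b e] s b(1) False by linarith
      have int: "integrable M (\<lambda>y. norm (riesz_integrand e y))"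
        by (rule integrable_const_bound[where B="b powr (- s)"]) (use bound in auto)
      have "norm (truncated_riesz s M e x) \<le> (\<integral>y. norm (riesz_integrand e y) \<partial>M)"
        unfolding truncated_riesz_eq by (rule integral_norm_bound)
      also have "\<dots> \<le> (\<integral>y. b powr (- s) \<partial>M)"
        by (intro integral_mono int bound) simp
      finally show ?thesis by (simp add: mult.commute)
    qed
  qed
qed

text \<open>For fixed \<open>y\<close> the kernel truncated at \<open>e / sqrt t\<close> is present
  exactly when \<open>e < u = sqrt t * norm (x - y)\<close>, and the density integrates over this
  range to \<open>u powr (s + 1) * exp (- u^2)\<close>, which cancels the denominator of the Riesz
  kernel. Fubini applies because the vanishing of the density like \<open>e powr s\<close> at 0
  compensates the size \<open>(e / sqrt t) powr (- s)\<close> of the kernel.\<close>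

lemma gauss_riesz_layer:
  assumes t: "0 < t"
  shows "t powr ((s + 1) / 2) *\<^sub>R gauss_riesz t M x
     = (\<integral>e. layer_density s e *\<^sub>R truncated_riesz s M (e / sqrt t) x \<partial>lborel)"
proof -
  interpret pair_sigma_finite M lborel
    by (intro pair_sigma_finite.intro lborel.sigma_finite_measure_axioms) (rule sigma_finite_measure_axioms)
  define f where "f y e = layer_density s e *\<^sub>R riesz_integrand (e / sqrt t) y" for y e
  define k where "k = nat \<lceil>s\<rceil>"
  have k: "s \<le> 2 * real k" using s by (simp add: k_def) linarith
  have [measurable]: "case_prod f \<in> borel_measurable (M \<Otimes>\<^sub>M lborel)"
    unfolding f_def riesz_integrand_def by measurable
  have f_le: "norm (f y e) \<le> t powr (s / 2) * layer_majorant k s e" for y e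
  proof (cases "e > 0")
    case True
    have "norm (f y e) = \<bar>layer_density s e\<bar> * norm (riesz_integrand (e / sqrt t) y)" by (simp add: f_def)
    also have "\<dots> \<le> \<bar>layer_density s e\<bar> * (e / sqrt t) powr (- s)"
      using True t by (intro mult_left_mono norm_riesz_integrand_le) auto
    also have "(e / sqrt t) powr (- s) = e powr (- s) * t powr (s / 2)"
      using True t by (simp add: powr_divide powr_half_sqrt[symmetric] powr_powr powr_minus field_simps)
    also have "\<bar>layer_density s e\<bar> * (e powr (- s) * t powr (s / 2)) = t powr (s / 2) * (\<bar>layer_density s e\<bar> * e powr (- s))"
      by (simp add: mult_ac)
    also have "\<dots> \<le> t powr (s / 2) * layer_majorant k s e"
      by (intro mult_left_mono layer_density_le(2) s k) simp
    finally show ?thesis .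
  next
    case False
    have "0 \<le> layer_majorant k s e" using s by (simp add: layer_majorant_def)
    then show ?thesis using False by (simp add: f_def layer_density_def)
  qed
  have int2: "integrable lborel (f y)" for y
  proof (rule Bochner_Integration.integrable_bound)
    show "integrable lborel (\<lambda>e. t powr (s / 2) * layer_majorant k s e)"
      by (intro integrable_mult_right integrable_layer_majorant)
    show "f y \<in> borel_measurable lborel"
      unfolding f_def[abs_def] riesz_integrand_def by measurable
    show "AE e in lborel. norm (f y e) \<le> norm (t powr (s / 2) * layer_majorant k s e)"
      using f_le[of y] by (intro AE_I2) (metis abs_ge_self order_trans real_norm_def)
  qed
  have int: "integrable (M \<Otimes>\<^sub>M lborel) (case_prod f)"
  proof (rule Fubini_integrable)
    show "AE y in M. integrable lborel (\<lambda>e. case_prod f (y, e))" using int2 by auto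
    have le: "(\<integral>e. norm (f y e) \<partial>lborel) \<le> (\<integral>e. t powr (s / 2) * layer_majorant k s e \<partial>lborel)" for y
      by (intro integral_mono f_le integrable_norm int2 integrable_mult_right integrable_layer_majorant)
    show "integrable M (\<lambda>y. \<integral>e. norm (case_prod f (y, e)) \<partial>lborel)"
      by (rule integrable_const_bound[where B="\<integral>e. t powr (s / 2) * layer_majorant k s e \<partial>lborel"])
        (use le in auto)
  qed measurable
  have inner: "(\<integral>e. f y e \<partial>lborel) = t powr ((s + 1) / 2) *\<^sub>R (exp (- t * (norm (x - y))\<^sup>2) *\<^sub>R (x - y))" for y
  proof -
    define u where "u = sqrt t * norm (x - y)"
    have u: "0 \<le> u" "u\<^sup>2 = t * (norm (x - y))\<^sup>2" using t by (auto simp: u_def power_mult_distrib)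
    have "f y e = (layer_density s e * indicator {..<u} e) *\<^sub>R ((x - y) /\<^sub>R (norm (x - y) powr (s + 1)))" for e
      using t by (simp add: f_def riesz_integrand_def u_def indicator_def field_simps)
    then have "(\<integral>e. f y e \<partial>lborel)
        = (\<integral>e. layer_density s e * indicator {..<u} e \<partial>lborel) *\<^sub>R ((x - y) /\<^sub>R (norm (x - y) powr (s + 1)))"
      by (simp only:) (rule integral_scaleR_left,
        rule Bochner_Integration.integrable_bound[OF integrable_layer_density[OF s]], auto simp: indicator_def)
    also have "\<dots> = (u powr (s + 1) * exp (- u\<^sup>2)) *\<^sub>R ((x - y) /\<^sub>R (norm (x - y) powr (s + 1)))"
      by (simp only: layer_density_integral[OF s u(1)])
    also have "u powr (s + 1) = t powr ((s + 1) / 2) * norm (x - y) powr (s + 1)"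
      unfolding u_def using t by (simp add: powr_mult powr_half_sqrt[symmetric] powr_powr)
    also have "(t powr ((s + 1) / 2) * norm (x - y) powr (s + 1) * exp (- u\<^sup>2)) *\<^sub>R ((x - y) /\<^sub>R (norm (x - y) powr (s + 1)))
      = t powr ((s + 1) / 2) *\<^sub>R (exp (- u\<^sup>2) *\<^sub>R (x - y))"
      by (cases "x = y") (auto simp: field_simps)
    finally show ?thesis unfolding u(2) by simp
  qed
  have "(\<integral>e. layer_density s e *\<^sub>R truncated_riesz s M (e / sqrt t) x \<partial>lborel) = (\<integral>e. (\<integral>y. f y e \<partial>M) \<partial>lborel)"
    unfolding truncated_riesz_eq f_def by simp
  also have "\<dots> = (\<integral>y. (\<integral>e. f y e \<partial>lborel) \<partial>M)" by (rule Fubini_integral[OF int])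
  also have "\<dots> = t powr ((s + 1) / 2) *\<^sub>R gauss_riesz t M x"
    unfolding inner gauss_riesz_def by (intro integral_scaleR_right integrable_gauss_riesz fM sM t)
  finally show ?thesis by (rule sym)
qed

text \<open>In the layer formula the truncation \<open>e / sqrt t\<close> tends to 0 for each fixed
  \<open>e > 0\<close>, so by dominated convergence the limit is \<open>l\<close> times the total
  integral of the density, which is 0.\<close>

lemma principal_value_imp_gauss_riesz:
  assumes lim: "((\<lambda>\<epsilon>. truncated_riesz s M \<epsilon> x) \<longlongrightarrow> l) (at_right 0)"
  shows "((\<lambda>t. t powr ((s + 1) / 2) *\<^sub>R gauss_riesz t M x) \<longlongrightarrow> 0) at_top"
proof -
  obtain B where B: "\<And>e. e > 0 \<Longrightarrow> norm (truncated_riesz s M e x) \<le> B"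
    using truncated_riesz_bounded[OF lim] by auto
  have [measurable]: "(\<lambda>e. truncated_riesz s M e x) \<in> borel_measurable borel"
    unfolding truncated_riesz_eq riesz_integrand_def by measurable
  have "((\<lambda>t. \<integral>e. layer_density s e *\<^sub>R truncated_riesz s M (e / sqrt t) x \<partial>lborel)
      \<longlongrightarrow> (\<integral>e. layer_density s e *\<^sub>R l \<partial>lborel)) at_top"
  proof (rule integral_dominated_convergence_at_top)
    show "integrable lborel (\<lambda>e. \<bar>layer_density s e\<bar> * B)"
      using integrable_layer_density[OF s] by simp
    show "AE e in lborel. ((\<lambda>t. layer_density s e *\<^sub>R truncated_riesz s M (e / sqrt t) x) \<longlongrightarrow> layer_density s e *\<^sub>R l) at_top"
    proof (intro AE_I2)
      fix e :: real
      show "((\<lambda>t. layer_density s e *\<^sub>R truncated_riesz s M (e / sqrt t) x) \<longlongrightarrow> layer_density s e *\<^sub>R l) at_top"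
      proof (cases "e > 0")
        case True
        have "filterlim (\<lambda>t. e / sqrt t) (at_right 0) at_top" using True by real_asymp
        from filterlim_compose[OF lim this] show ?thesis by (intro tendsto_intros)
      qed (simp add: layer_density_def)
    qed
    show "\<forall>\<^sub>F t in at_top. AE e in lborel. norm (layer_density s e *\<^sub>R truncated_riesz s M (e / sqrt t) x)
        \<le> \<bar>layer_density s e\<bar> * B"
      using eventually_gt_at_top[of 0]
    proof eventually_elim
      case (elim t)
      show ?case
      proof (intro AE_I2)
        fix e
        show "norm (layer_density s e *\<^sub>R truncated_riesz s M (e / sqrt t) x) \<le> \<bar>layer_density s e\<bar> * B"
          using elim B[of "e / sqrt t"] by (cases "e > 0") (auto simp: layer_density_def intro!: mult_left_mono)
      qed
    qed
  qed measurable
  also have "(\<integral>e. layer_density s e *\<^sub>R l \<partial>lborel) = 0"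
    using integral_scaleR_left[OF integrable_layer_density[OF s], of l] layer_density_integral_UNIV[OF s] by simp
  finally show ?thesis
    by (rule Lim_transform_eventually)
      (use eventually_gt_at_top[of 0] in \<open>eventually_elim, simp add: gauss_riesz_layer\<close>)
qed

end

section \<open>Blowing up at density points\<close>

text \<open>
  The growth bound on \<open>F\<close> replaces doubling in the Vitali covering argument.
\<close>
lemma AE_density_outside_zero:
  fixes M :: "'a::euclidean_space measure"
  assumes fM: "finite_measure M" and sM: "sets M = sets borel" and F: "closed F"
    and gr: "\<And>x r. x \<in> F \<Longrightarrow> r > 0 \<Longrightarrow> measure M (ball x r) \<le> C * r powr s"
    and C: "0 \<le> C" and \<eta>: "0 < \<eta>"
  shows "AE x in M. x \<in> F \<longrightarrow> (\<exists>r0>0. \<forall>r. 0 < r \<longrightarrow> r < r0 \<longrightarrow> measure M (ball x r - F) \<le> \<eta> * r powr s)"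
proof -
  interpret finite_measure M by fact
  have [measurable]: "F \<in> sets borel" using F by (rule borel_closed)
  \<comment> \<open>This is the set of bad points. It is enclosed in Borel sets \<open>W n\<close>
    of mass tending to 0, so its own measurability never has to be discussed.\<close>
  define A where "A = {x \<in> F. \<forall>r0>0. \<exists>r. 0 < r \<and> r < r0 \<and> \<eta> * r powr s < measure M (ball x r - F)}"
  define U where "U n = (\<Union>x\<in>F. ball x (1 / real (Suc n))) - F" for n
  have Uo [measurable]: "U n \<in> sets borel" for n
    unfolding U_def by (rule sets.Diff[OF borel_open]) auto
  have U0: "(\<Inter>n. U n) = {}"
  proof -
    have "x \<in> F" if "x \<in> (\<Inter>n. U n)" for x
    proof -
      have "\<exists>y\<in>F. dist y x < e" if e: "e > 0" for e
      proof -
        obtain n where n: "1 / real (Suc n) < e" using nat_approx_posE[OF e] by metis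
        obtain y where "y \<in> F" "dist y x < 1 / real (Suc n)"
          using \<open>x \<in> (\<Inter>n. U n)\<close> by (auto simp: U_def)
        with n show ?thesis by (meson less_trans)
      qed
      then show ?thesis using closed_approachable[OF F] by blast
    qed
    then show ?thesis by (force simp: U_def)
  qed
  \<comment> \<open>Since \<open>F\<close> is closed, the punctured neighbourhoods
    \<open>U n\<close> decrease to the empty set.\<close>
  have Ulim: "(\<lambda>n. measure M (U n)) \<longlonglongrightarrow> 0"
  proof -
    have "decseq U"
    proof (rule decseq_SucI)
      fix n
      have "1 / real (Suc (Suc n)) \<le> 1 / real (Suc n)" by (intro divide_left_mono) auto
      then show "U (Suc n) \<subseteq> U n" unfolding U_def by (intro Diff_mono UN_mono subset_ball) auto
    qed
    then have "(\<lambda>n. measure M (U n)) \<longlonglongrightarrow> measure M (\<Inter>n. U n)"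
      by (intro finite_Lim_measure_decseq) (auto simp: sM)
    then show ?thesis using U0 by simp
  qed
  have "\<exists>W\<in>sets borel. A \<subseteq> W \<and> measure M W \<le> C * 6 powr s / \<eta> * measure M (U n)" for n
  proof (cases "A = {}")
    case True
    then show ?thesis using C \<eta> by (intro bexI[of _ "{}"]) auto
  next
    case False
    \<comment> \<open>Radii below \<open>1 / Suc n\<close> keep each ball, with \<open>F\<close>
      removed, inside \<open>U n\<close>.\<close>
    have "\<forall>x\<in>A. \<exists>r. 0 < r \<and> r < 1 / real (Suc n) \<and> \<eta> * r powr s < measure M (ball x r - F)"
      by (auto simp: A_def)
    then obtain \<rho> where \<rho>: "\<And>x. x \<in> A \<Longrightarrow> 0 < \<rho> x" "\<And>x. x \<in> A \<Longrightarrow> \<rho> x < 1 / real (Suc n)"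
      "\<And>x. x \<in> A \<Longrightarrow> \<eta> * \<rho> x powr s < measure M (ball x (\<rho> x) - F)"
      by metis
    have "A \<subseteq> (\<Union>x\<in>A. cball x (\<rho> x))"
    proof
      fix x assume x: "x \<in> A"
      then show "x \<in> (\<Union>x\<in>A. cball x (\<rho> x))" using \<rho>(1)[OF x] by (intro UN_I[OF x]) simp
    qed
    moreover have "0 < \<rho> x \<and> \<rho> x \<le> 1 / real (Suc n)" if "x \<in> A" for x
      using \<rho>[OF that] by simp
    ultimately obtain D where D: "countable D" "D \<subseteq> A"
      "pairwise (\<lambda>i j. disjnt (cball i (\<rho> i)) (cball j (\<rho> j))) D"
      "A \<subseteq> (\<Union>i\<in>D. cball i (5 * \<rho> i))"
      by (rule Vitali_covering_lemma_cballs)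
    have "D \<noteq> {}" using False D(4) by auto
    \<comment> \<open>The countable Vitali family is exhausted by finite stages: the estimate is
      proved for each stage and passes to the union by continuity from below.\<close>
    define J where "J k = from_nat_into D ` {..<k}" for k
    have J: "finite (J k)" "J k \<subseteq> D" for k
      using from_nat_into[OF \<open>D \<noteq> {}\<close>] by (auto simp: J_def)
    have JD: "(\<Union>k. J k) = D"
    proof -
      have "(\<Union>k. J k) = range (from_nat_into D)" by (auto simp: J_def)
      then show ?thesis using range_from_nat_into[OF \<open>D \<noteq> {}\<close> D(1)] by simp
    qed
    \<comment> \<open>Open balls of radius \<open>6 * \<rho> i\<close> contain the closed Vitali
      balls of radius \<open>5 * \<rho> i\<close>. Their mass is controlled by growth at points of
      \<open>A \<subseteq> F\<close>, which turns it into a multiple of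
      \<open>\<rho> i powr s\<close> and hence of the mass outside \<open>F\<close> in the disjoint
      small balls.\<close>
    define W where "W k = (\<Union>i\<in>J k. ball i (6 * \<rho> i))" for k
    have Wb [measurable]: "W k \<in> sets borel" for k
      unfolding W_def by (intro borel_open open_UN) auto
    have "measure M (W k) \<le> C * 6 powr s / \<eta> * measure M (U n)" for k
    proof -
      have JA: "i \<in> A" if "i \<in> J k" for i using that J(2)[of k] D(2) by auto
      have "measure M (W k) \<le> (\<Sum>i\<in>J k. measure M (ball i (6 * \<rho> i)))"
        unfolding W_def using J(1) by (intro finite_measure_subadditive_finite) (auto simp: sM)
      also have "\<dots> \<le> (\<Sum>i\<in>J k. C * 6 powr s / \<eta> * measure M (ball i (\<rho> i) - F))"
      proof (rule sum_mono)
        fix i assume i: "i \<in> J k"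
        have "measure M (ball i (6 * \<rho> i)) \<le> C * (6 * \<rho> i) powr s"
          using JA[OF i] \<rho>(1)[OF JA[OF i]] by (intro gr) (auto simp: A_def)
        also have "\<dots> = C * 6 powr s / \<eta> * (\<eta> * \<rho> i powr s)"
          using \<rho>(1)[OF JA[OF i]] \<eta> by (simp add: powr_mult)
        also have "\<dots> \<le> C * 6 powr s / \<eta> * measure M (ball i (\<rho> i) - F)"
          using C \<eta> \<rho>(3)[OF JA[OF i]] by (intro mult_left_mono) auto
        finally show "measure M (ball i (6 * \<rho> i)) \<le> C * 6 powr s / \<eta> * measure M (ball i (\<rho> i) - F)" .
      qed
      also have "\<dots> = C * 6 powr s / \<eta> * (\<Sum>i\<in>J k. measure M (ball i (\<rho> i) - F))"
        by (simp add: sum_distrib_left)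
      also have "(\<Sum>i\<in>J k. measure M (ball i (\<rho> i) - F)) = measure M (\<Union>i\<in>J k. ball i (\<rho> i) - F)"
      proof (rule finite_measure_finite_Union[symmetric])
        show "finite (J k)" by (rule J)
        show "(\<lambda>i. ball i (\<rho> i) - F) ` J k \<subseteq> sets M" by (auto simp: sM)
        have "ball i (\<rho> i) \<inter> ball j (\<rho> j) = {}" if "i \<in> J k" "j \<in> J k" "i \<noteq> j" for i j
        proof -
          have "disjnt (cball i (\<rho> i)) (cball j (\<rho> j))"
            using D(3) J(2)[of k] that by (auto simp: pairwise_def)
          then show ?thesis 
            using ball_subset_cball[of i "\<rho> i"] ball_subset_cball[of j "\<rho> j"] unfolding disjnt_def by blast
        qed
        then show "disjoint_family_on (\<lambda>i. ball i (\<rho> i) - F) (J k)"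
          unfolding disjoint_family_on_def by blast
      qed
      also have "C * 6 powr s / \<eta> * measure M (\<Union>i\<in>J k. ball i (\<rho> i) - F)
          \<le> C * 6 powr s / \<eta> * measure M (U n)"
      proof (intro mult_left_mono finite_measure_mono)
        show "(\<Union>i\<in>J k. ball i (\<rho> i) - F) \<subseteq> U n"
        proof
          fix y assume "y \<in> (\<Union>i\<in>J k. ball i (\<rho> i) - F)"
          then obtain i where i: "i \<in> J k" "y \<in> ball i (\<rho> i)" "y \<notin> F" by auto
          have "i \<in> F" using JA[OF i(1)] by (simp add: A_def)
          moreover have "y \<in> ball i (1 / real (Suc n))"
            using i(2) \<rho>(2)[OF JA[OF i(1)]] by simp
          ultimately show "y \<in> U n" using i(3) by (auto simp: U_def)
        qed
      qed (use C \<eta> in \<open>auto simp: sM\<close>)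
      finally show ?thesis .
    qed
    moreover have "incseq W"
      unfolding W_def J_def by (intro incseq_SucI UN_mono) auto
    then have "(\<lambda>k. measure M (W k)) \<longlonglongrightarrow> measure M (\<Union>k. W k)"
      by (intro finite_Lim_measure_incseq) (auto simp: sM)
    ultimately have "measure M (\<Union>k. W k) \<le> C * 6 powr s / \<eta> * measure M (U n)"
      by (intro LIMSEQ_le_const2) auto
    moreover have "A \<subseteq> (\<Union>k. W k)"
    proof
      fix x assume "x \<in> A"
      then obtain i where i: "i \<in> D" "x \<in> cball i (5 * \<rho> i)" using D(4) by auto
      then have "x \<in> ball i (6 * \<rho> i)" using \<rho>(1)[of i] D(2) by auto
      moreover obtain k where "i \<in> J k" using i(1) JD by auto
      ultimately show "x \<in> (\<Union>k. W k)" unfolding W_def by blast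
    qed
    ultimately show ?thesis by (intro bexI[of _ "\<Union>k. W k"]) auto
  qed
  then obtain W where W: "\<And>n. W n \<in> sets borel" "\<And>n. A \<subseteq> W n"
    "\<And>n. measure M (W n) \<le> C * 6 powr s / \<eta> * measure M (U n)"
    by metis
  have "measure M (\<Inter>n. W n) \<le> 0"
  proof (rule LIMSEQ_le_const)
    show "(\<lambda>n. C * 6 powr s / \<eta> * measure M (U n)) \<longlonglongrightarrow> 0"
      using tendsto_mult_right_zero[OF Ulim] .
    have "measure M (\<Inter>n. W n) \<le> C * 6 powr s / \<eta> * measure M (U n)" for n
    proof -
      have "measure M (\<Inter>n. W n) \<le> measure M (W n)"
        using W(1) by (intro finite_measure_mono) (auto simp: sM)
      then show ?thesis using W(3)[of n] by linarith
    qed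
    then show "\<exists>N. \<forall>n\<ge>N. measure M (\<Inter>n. W n) \<le> C * 6 powr s / \<eta> * measure M (U n)" by blast
  qed
  then have "measure M (\<Inter>n. W n) = 0" by (rule antisym) (rule measure_nonneg)
  then have null: "emeasure M (\<Inter>n. W n) = 0" by (simp add: emeasure_eq_measure)
  show ?thesis
  proof (rule AE_I[OF _ null])
    show "(\<Inter>n. W n) \<in> sets M" using W(1) by (auto simp: sM)
    show "{x \<in> space M. \<not> (x \<in> F \<longrightarrow> (\<exists>r0>0. \<forall>r. 0 < r \<longrightarrow> r < r0 \<longrightarrow> measure M (ball x r - F) \<le> \<eta> * r powr s))}
      \<subseteq> (\<Inter>n. W n)"
    proof -
      have "{x \<in> space M. \<not> (x \<in> F \<longrightarrow> (\<exists>r0>0. \<forall>r. 0 < r \<longrightarrow> r < r0 \<longrightarrow> measure M (ball x r - F) \<le> \<eta> * r powr s))}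
        \<subseteq> A" by (auto simp: A_def not_le)
      then show ?thesis using W(2) by blast
    qed
  qed
qed

text \<open>A ball of radius \<open>r\<close> at a limit point lies in a ball of radius
  \<open>r + e\<close> at a nearby point of the set; then \<open>e\<close> tends to 0. Closedness is
  what the density lemma asks of the good set.\<close>

lemma closed_growth_set:
  fixes M :: "'a::euclidean_space measure"
  assumes "finite_measure M" "sets M = sets borel"
  shows "closed {x. \<forall>r>0. measure M (ball x r) \<le> C * r powr s}"
  unfolding closed_sequential_limits
proof (intro allI impI, elim conjE, safe)
  fix X x and r :: real
  assume X: "\<forall>n. X n \<in> {x. \<forall>r>0. measure M (ball x r) \<le> C * r powr s}" "X \<longlonglongrightarrow> x" and r: "r > 0"
  interpret finite_measure M by fact
  show "measure M (ball x r) \<le> C * r powr s"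
  proof (rule tendsto_lowerbound)
    show "((\<lambda>e. C * (r + e) powr s) \<longlongrightarrow> C * r powr s) (at_right 0)"
      using r by (auto intro!: tendsto_eq_intros)
    show "\<forall>\<^sub>F e in at_right 0. measure M (ball x r) \<le> C * (r + e) powr s"
      using eventually_at_right_less[of 0]
    proof eventually_elim
      case (elim e)
      obtain n where n: "dist (X n) x < e"
        using X(2) elim by (meson lim_sequentially order_refl)
      have "ball x r \<subseteq> ball (X n) (r + e)"
      proof
        fix y assume "y \<in> ball x r"
        then show "y \<in> ball (X n) (r + e)" using n dist_triangle[of "X n" y x] by simp
      qed
      then have "measure M (ball x r) \<le> measure M (ball (X n) (r + e))"
        using assms(2) by (intro finite_measure_mono) auto
      also have "\<dots> \<le> C * (r + e) powr s" using X(1) r elim by auto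
      finally show ?case .
    qed
  qed simp
qed

section \<open>Continuity and scaling of the Gaussian transform\<close>

lemma continuous_gauss_riesz:
  fixes M :: "'a::euclidean_space measure"
  assumes "finite_measure M" and [measurable_cong]: "sets M = sets borel" and t: "0 < t"
  shows "continuous_on UNIV (gauss_riesz t M)"
  unfolding continuous_on_sequentially
proof (intro ballI allI impI, elim conjE)
  fix x :: 'a and X assume X: "X \<longlonglongrightarrow> x"
  interpret finite_measure M by fact
  show "(gauss_riesz t M \<circ> X) \<longlonglongrightarrow> gauss_riesz t M x"
    unfolding gauss_riesz_def comp_def
  proof (rule integral_dominated_convergence[where w="\<lambda>_. 1 / t + 1"])
    show "AE y in M. (\<lambda>n. exp (- t * (norm (X n - y))\<^sup>2) *\<^sub>R (X n - y)) \<longlonglongrightarrow> exp (- t * (norm (x - y))\<^sup>2) *\<^sub>R (x - y)"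
      by (intro AE_I2 tendsto_intros X)
    show "AE y in M. norm (exp (- t * (norm (X n - y))\<^sup>2) *\<^sub>R (X n - y)) \<le> 1 / t + 1" for n
      using norm_times_gaussian_le[OF t] by (auto simp: mult.commute)
  qed auto
qed

text \<open>With \<open>a = r powr - s\<close> the total factor is
  \<open>(r^2) powr (- (s + 1) / 2)\<close>, so the transform normalized by
  \<open>t powr ((s + 1) / 2)\<close> is invariant under the blow-up, with parameter
  \<open>t / r^2\<close> upstairs.\<close>

lemma gauss_riesz_affine:
  fixes M :: "'a::euclidean_space measure"
  assumes fM: "finite_measure M" and sM [measurable_cong]: "sets M = sets borel" and r: "0 < r" and t: "0 < t"
    and a: "0 \<le> a"
  shows "gauss_riesz t (distr (density M (\<lambda>_. ennreal a)) borel (\<lambda>y. (y - x0) /\<^sub>R r)) z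
     = (a / r) *\<^sub>R gauss_riesz (t / r\<^sup>2) M (x0 + r *\<^sub>R z)"
proof -
  have eq: "z - (y - x0) /\<^sub>R r = ((x0 + r *\<^sub>R z) - y) /\<^sub>R r" for y
    using r by (simp add: algebra_simps)
  have "gauss_riesz t (distr (density M (\<lambda>_. ennreal a)) borel (\<lambda>y. (y - x0) /\<^sub>R r)) z
    = (\<integral>y. a *\<^sub>R (exp (- t * (norm (z - (y - x0) /\<^sub>R r))\<^sup>2) *\<^sub>R (z - (y - x0) /\<^sub>R r)) \<partial>M)"
    unfolding gauss_riesz_def using a by (subst integral_distr, measurable) (subst integral_density, auto)
  also have "\<dots> = (\<integral>y. (a / r) *\<^sub>R (exp (- (t / r\<^sup>2) * (norm ((x0 + r *\<^sub>R z) - y))\<^sup>2) *\<^sub>R ((x0 + r *\<^sub>R z) - y)) \<partial>M)"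
    unfolding eq using r by (intro Bochner_Integration.integral_cong refl)
      (simp add: power_divide power_mult_distrib power_inverse divide_inverse mult_ac)
  also have "\<dots> = (a / r) *\<^sub>R gauss_riesz (t / r\<^sup>2) M (x0 + r *\<^sub>R z)"
    unfolding gauss_riesz_def
    using r t by (intro integral_scaleR_right integrable_gauss_riesz[OF fM sM] divide_pos_pos zero_less_power)
  finally show ?thesis .
qed

lemma measure_affine:
  fixes M :: "'a::euclidean_space measure"
  assumes fM: "finite_measure M" and sM [measurable_cong]: "sets M = sets borel" and a: "0 \<le> a" and A: "A \<in> sets borel"
  shows "measure (distr (density M (\<lambda>_. ennreal a)) borel (\<lambda>y. (y - x0) /\<^sub>R r)) A
     = a * measure M {y. (y - x0) /\<^sub>R r \<in> A}"
proof -
  interpret finite_measure M by fact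
  have sp: "space M = UNIV" using sets_eq_imp_space_eq[OF sM] by simp
  have "emeasure (distr (density M (\<lambda>_. ennreal a)) borel (\<lambda>y. (y - x0) /\<^sub>R r)) A
     = emeasure (density M (\<lambda>_. ennreal a)) {y. (y - x0) /\<^sub>R r \<in> A}"
    using A by (subst emeasure_distr) (auto simp: sp vimage_def)
  also have "\<dots> = ennreal a * emeasure M {y. (y - x0) /\<^sub>R r \<in> A}"
  proof (rule emeasure_density_const)
    show "{y. (y - x0) /\<^sub>R r \<in> A} \<in> sets M"
      using A by measurable
  qed
  finally show ?thesis using a by (simp add: measure_def enn2real_mult)
qed

lemma finite_measure_affine:
  fixes M :: "'a::euclidean_space measure"
  assumes fM: "finite_measure M" and sM [measurable_cong]: "sets M = sets borel"
  shows "finite_measure (distr (density M (\<lambda>_. ennreal a)) borel (\<lambda>y. (y - x0) /\<^sub>R r))"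
proof (rule finite_measure.finite_measure_distr)
  interpret finite_measure M by fact
  show "finite_measure (density M (\<lambda>_. ennreal a))"
    by (rule finite_measureI)
      (simp add: emeasure_density_const emeasure_eq_measure ennreal_mult_eq_top_iff)
qed measurable

text \<open>The points with growth constant \<open>C\<close> and small normalized transforms from
  some parameter on form a closed set. At almost each of its points the rest of the measure has
  negligible density, so every sufficiently small blow-up meets the remaining conditions of
  \<open>no_approximately_symmetric_measure\<close> and has mass less than \<open>c\<close> in the
  unit ball. The order of quantifiers matters: \<open>\<epsilon>\<close> precedes \<open>k\<close>,
  because \<open>k\<close> will depend on the point.\<close>

lemma no_good_density_point:
  fixes M :: "'a::euclidean_space measure"
  assumes s: "0 < s" "s \<notin> \<int>" and C: "0 < C" and c: "0 < c"
    and fM: "finite_measure M" and sM: "sets M = sets borel"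
  shows "\<exists>\<epsilon>>0. \<forall>k::nat. AE x in M.
     (\<forall>r>0. measure M (ball x r) \<le> C * r powr s) \<longrightarrow>
     (\<forall>t\<ge>real k. norm (t powr ((s + 1) / 2) *\<^sub>R gauss_riesz t M x) \<le> \<epsilon>) \<longrightarrow>
     (\<exists>r0>0. \<forall>r. 0 < r \<longrightarrow> r < r0 \<longrightarrow> measure M (ball x r) < c * r powr s)"
proof -
  interpret finite_measure M by fact
  obtain \<epsilon> \<tau> where \<epsilon>: "0 < \<epsilon>" and \<tau>: "0 < \<tau>" "\<tau> \<le> 1"
    and core: "\<And>(N :: 'a measure) F. finite_measure N \<Longrightarrow> sets N = sets borel \<Longrightarrow> F \<in> sets borel \<Longrightarrow> 0 \<in> F \<Longrightarrow>
     (\<forall>x\<in>F. \<forall>r>0. measure N (ball x r) \<le> C * r powr s) \<Longrightarrow>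
     measure N (ball 0 1 - F) \<le> \<epsilon> \<Longrightarrow>
     (\<forall>x\<in>F. norm x < 1 \<longrightarrow> (\<forall>t\<in>{\<tau>..1}. norm (gauss_riesz t N x) \<le> \<epsilon>)) \<Longrightarrow>
     \<not> c \<le> measure N (ball 0 1)"
    using no_approximately_symmetric_measure[OF s C c, where 'a='a] by blast
  \<comment> \<open>The extra factor compensates \<open>t powr (- (s + 1) / 2)\<close> for
    \<open>t \<ge> \<tau>\<close>, when the normalization is removed.\<close>
  define \<epsilon>' where "\<epsilon>' = \<epsilon> * \<tau> powr ((s + 1) / 2)"
  have "AE x in M.
     (\<forall>r>0. measure M (ball x r) \<le> C * r powr s) \<longrightarrow>
     (\<forall>t\<ge>real k. norm (t powr ((s + 1) / 2) *\<^sub>R gauss_riesz t M x) \<le> \<epsilon>') \<longrightarrow>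
     (\<exists>r0>0. \<forall>r. 0 < r \<longrightarrow> r < r0 \<longrightarrow> measure M (ball x r) < c * r powr s)" for k :: nat
  proof -
    \<comment> \<open>Adding 1 keeps all parameters positive even for \<open>k = 0\<close>, so that
      the transforms are continuous and \<open>\<tau> / k1\<close> makes sense.\<close>
    define k1 where "k1 = real k + 1"
    have k1: "k1 > 0" by (simp add: k1_def)
    define F where "F = {x. \<forall>r>0. measure M (ball x r) \<le> C * r powr s}
        \<inter> (\<Inter>t\<in>{k1..}. {x. norm (t powr ((s + 1) / 2) *\<^sub>R gauss_riesz t M x) \<le> \<epsilon>'})"
    have "closed F"
      unfolding F_def using k1
      by (intro closed_Int closed_growth_set fM sM closed_INT ballI closed_Collect_le continuous_intros
          continuous_gauss_riesz) auto
    have Fb: "F \<in> sets borel" using \<open>closed F\<close> by (rule borel_closed)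
    have "AE x in M. x \<in> F \<longrightarrow> (\<exists>r0>0. \<forall>r. 0 < r \<longrightarrow> r < r0 \<longrightarrow> measure M (ball x r - F) \<le> \<epsilon> * r powr s)"
      by (rule AE_density_outside_zero[OF fM sM \<open>closed F\<close>, of C]) (use C \<epsilon> in \<open>auto simp: F_def\<close>)
    then show ?thesis
    proof eventually_elim
      case (elim x0)
      show ?case
      proof (intro impI)
        assume "\<forall>r>0. measure M (ball x0 r) \<le> C * r powr s"
          and "\<forall>t\<ge>real k. norm (t powr ((s + 1) / 2) *\<^sub>R gauss_riesz t M x0) \<le> \<epsilon>'"
        then have x0: "x0 \<in> F" by (auto simp: F_def k1_def)
        then obtain r0 where r0: "r0 > 0"
          "\<And>r. 0 < r \<Longrightarrow> r < r0 \<Longrightarrow> measure M (ball x0 r - F) \<le> \<epsilon> * r powr s"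
          using elim by auto
        \<comment> \<open>The bound \<open>sqrt (\<tau> / k1)\<close> on \<open>r\<close> ensures
          \<open>t / r^2 \<ge> k1\<close> for all \<open>t \<ge> \<tau>\<close>, the range where
          membership in \<open>F\<close> controls the transform.\<close>
        have "measure M (ball x0 r) < c * r powr s" if r: "0 < r" "r < min r0 (sqrt (\<tau> / k1))" for r
        proof -
          \<comment> \<open>The weight \<open>r powr - s\<close> makes the blow-up preserve the
            growth constant \<open>C\<close>.\<close>
          let ?N = "distr (density M (\<lambda>_. ennreal (r powr - s))) borel (\<lambda>y. (y - x0) /\<^sub>R r)"
          define F' where "F' = {z. x0 + r *\<^sub>R z \<in> F}"
          have F'b: "F' \<in> sets borel"
          proof -
            have "closed ((\<lambda>z. x0 + r *\<^sub>R z) -` F)"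
              by (intro closed_vimage \<open>closed F\<close> continuous_intros)
            then show ?thesis unfolding F'_def vimage_def by (rule borel_closed)
          qed
          have meas: "measure ?N A = r powr - s * measure M {y. (y - x0) /\<^sub>R r \<in> A}" if "A \<in> sets borel" for A
            using that by (intro measure_affine fM sM) auto
          have pre: "{y. (y - x0) /\<^sub>R r \<in> ball z q} = ball (x0 + r *\<^sub>R z) (r * q)" for z q
          proof -
            have "dist z ((y - x0) /\<^sub>R r) < q \<longleftrightarrow> dist (x0 + r *\<^sub>R z) y < r * q" for y
            proof -
              have "z - (y - x0) /\<^sub>R r = ((x0 + r *\<^sub>R z) - y) /\<^sub>R r"
                using r by (simp add: algebra_simps)
              then have "dist z ((y - x0) /\<^sub>R r) = dist (x0 + r *\<^sub>R z) y / r"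
                using r by (simp add: dist_norm divide_inverse mult.commute)
              then show ?thesis by (simp only: pos_divide_less_eq[OF r(1)] mult.commute)
            qed
            then show ?thesis unfolding set_eq_iff mem_Collect_eq mem_ball by blast
          qed
          have mball: "measure ?N (ball z q) = r powr - s * measure M (ball (x0 + r *\<^sub>R z) (r * q))" for z q
            unfolding pre[symmetric] by (rule meas) simp
          have "\<not> c \<le> measure ?N (ball 0 1)"
          proof (rule core)
            show "finite_measure ?N" by (rule finite_measure_affine[OF fM sM])
            show "sets ?N = sets borel" by simp
            show "F' \<in> sets borel" by (rule F'b)
            show "0 \<in> F'" using x0 by (simp add: F'_def)
            show "\<forall>x\<in>F'. \<forall>q>0. measure ?N (ball x q) \<le> C * q powr s"
            proof (intro ballI allI impI)
              fix z and q :: real assume z: "z \<in> F'" and q: "q > 0"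
              have "measure ?N (ball z q) = r powr - s * measure M (ball (x0 + r *\<^sub>R z) (r * q))"
                by (rule mball)
              also have "\<dots> \<le> r powr - s * (C * (r * q) powr s)"
                using z q r by (intro mult_left_mono) (auto simp: F'_def F_def)
              also have "\<dots> = C * q powr s" using r q by (simp add: powr_mult powr_minus field_simps)
              finally show "measure ?N (ball z q) \<le> C * q powr s" .
            qed
            have "{y. (y - x0) /\<^sub>R r \<in> ball 0 1 - F'} = ball x0 r - F"
            proof -
              have "x0 + r *\<^sub>R ((y - x0) /\<^sub>R r) = y" for y using r by simp
              then show ?thesis using pre[of 0 1] unfolding F'_def set_eq_iff by simp
            qed
            then have "measure ?N (ball 0 1 - F') = r powr - s * measure M (ball x0 r - F)"
              using F'b by (subst meas) auto
            also have "\<dots> \<le> r powr - s * (\<epsilon> * r powr s)"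
              using r by (intro mult_left_mono r0) auto
            also have "\<dots> = \<epsilon>" using r by (simp add: powr_minus)
            finally show "measure ?N (ball 0 1 - F') \<le> \<epsilon>" .
            show "\<forall>x\<in>F'. norm x < 1 \<longrightarrow> (\<forall>t\<in>{\<tau>..1}. norm (gauss_riesz t ?N x) \<le> \<epsilon>)"
            proof (intro ballI impI)
              fix z t assume z: "z \<in> F'" and t: "t \<in> {\<tau>..1}"
              have t0: "t > 0" using t \<tau> by auto
              let ?x = "x0 + r *\<^sub>R z" and ?p = "(s + 1) / 2"
              have "r\<^sup>2 < (sqrt (\<tau> / k1))\<^sup>2" using r by (intro power_strict_mono) auto
              then have "k1 * r\<^sup>2 < \<tau>" using \<tau> k1 by (simp add: field_simps)
              then have "k1 * r\<^sup>2 \<le> t" using t by auto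
              then have "k1 \<le> t / r\<^sup>2" using r by (simp add: field_simps)
              then have bound: "norm ((t / r\<^sup>2) powr ?p *\<^sub>R gauss_riesz (t / r\<^sup>2) M ?x) \<le> \<epsilon>'"
                using z by (auto simp: F'_def F_def)
              have "r powr - s / r = (r\<^sup>2) powr (- ?p)"
              proof -
                have "(r\<^sup>2) powr (- ?p) = (r powr 2) powr (- ?p)" using r by simp
                also have "\<dots> = r powr (2 * (- ?p))" by (rule powr_powr)
                also have "2 * (- ?p) = - s - 1" by (simp add: field_simps)
                also have "r powr (- s - 1) = r powr - s / r" using r by (simp add: powr_diff)
                finally show ?thesis by simp
              qed
              then have pw: "r powr - s / r = t powr (- ?p) * (t / r\<^sup>2) powr ?p"
                using t0 r by (simp add: powr_divide powr_minus field_simps)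
              have "norm (gauss_riesz t ?N z) = r powr - s / r * norm (gauss_riesz (t / r\<^sup>2) M ?x)"
                using r t0 by (subst gauss_riesz_affine[OF fM sM]) auto
              also have "\<dots> = t powr (- ?p) * norm ((t / r\<^sup>2) powr ?p *\<^sub>R gauss_riesz (t / r\<^sup>2) M ?x)"
                unfolding pw by simp
              also have "\<dots> \<le> t powr (- ?p) * \<epsilon>'" by (intro mult_left_mono bound) simp
              also have "\<dots> \<le> \<tau> powr (- ?p) * \<epsilon>'"
                using t \<tau> \<epsilon> s by (intro mult_right_mono powr_mono2') (auto simp: \<epsilon>'_def)
              also have "\<dots> = \<epsilon>" using \<tau> by (simp add: \<epsilon>'_def powr_minus)
              finally show "norm (gauss_riesz t ?N z) \<le> \<epsilon>" .
            qed
          qed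
          then have "r powr - s * measure M (ball x0 r) < c"
            using mball[of 0 1] by simp
          then show ?thesis using r by (simp add: powr_minus field_simps)
        qed
        moreover have "0 < min r0 (sqrt (\<tau> / k1))" using r0 \<tau> k1 by simp
        ultimately show "\<exists>r0>0. \<forall>r. 0 < r \<longrightarrow> r < r0 \<longrightarrow> measure M (ball x0 r) < c * r powr s"
          by blast
      qed
    qed
  qed
  moreover have "\<epsilon>' > 0" using \<epsilon> \<tau> by (simp add: \<epsilon>'_def)
  ultimately show ?thesis by blast
qed

text \<open>Finiteness of the limsup bounds the ratio for small radii; for radii at least
  \<open>b\<close> the total mass divided by \<open>b powr s\<close> does. The form
  \<open>Suc n\<close> makes the constant positive and the family of constants countable.\<close>

lemma upper_density_finite_imp_growth:
  fixes M :: "'a::euclidean_space measure"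
  assumes fM: "finite_measure M" and s: "0 < s" and fin: "upper_density s M x < \<infinity>"
  shows "\<exists>n::nat. \<forall>r>0. measure M (ball x r) \<le> real (Suc n) * r powr s"
proof -
  interpret finite_measure M by fact
  obtain k :: nat where "upper_density s M x < of_nat k"
    using fin ennreal_Ex_less_of_nat by (auto simp: less_top)
  then have "eventually (\<lambda>r. emeasure M (ball x r) / ennreal (r powr s) < of_nat k) (at_right 0)"
    unfolding upper_density_def by (rule Limsup_lessD)
  then obtain b where b: "b > 0"
    "\<And>r. 0 < r \<Longrightarrow> r < b \<Longrightarrow> emeasure M (ball x r) / ennreal (r powr s) < of_nat k"
    unfolding eventually_at_right_field by blast
  obtain n :: nat where n: "max (real k) (measure M (space M) / b powr s) \<le> real n"
    using real_arch_simple by blast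
  show ?thesis
  proof (intro exI allI impI)
    fix r :: real assume r: "r > 0"
    have "measure M (ball x r) \<le> real n * r powr s"
    proof (cases "r < b")
      case True
      have "ennreal (measure M (ball x r) / r powr s) < ennreal (real k)"
        using b(2)[OF r True] r by (simp add: emeasure_eq_measure divide_ennreal ennreal_of_nat_eq_real_of_nat)
      then have "measure M (ball x r) / r powr s \<le> real n"
        using n by (simp add: ennreal_less_iff)
      then show ?thesis using r by (simp add: field_simps)
    next
      case False
      have "measure M (ball x r) \<le> measure M (space M)" by (rule bounded_measure)
      also have "\<dots> \<le> real n * b powr s" using n b(1) by (simp add: field_simps)
      also have "\<dots> \<le> real n * r powr s" using False b(1) s by (intro mult_left_mono powr_mono2) auto
      finally show ?thesis .
    qed
    also have "\<dots> \<le> real (Suc n) * r powr s" by (intro mult_right_mono) auto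
    finally show "measure M (ball x r) \<le> real (Suc n) * r powr s" .
  qed
qed

text \<open>If the ratio were eventually below \<open>1 / Suc n\<close> for every \<open>n\<close>,
  the limsup would be 0. The conclusion is the negation of the last clause of
  \<open>no_good_density_point\<close>.\<close>

lemma upper_density_pos_imp_frequently:
  fixes M :: "'a::euclidean_space measure"
  assumes fM: "finite_measure M" and pos: "0 < upper_density s M x"
  shows "\<exists>n::nat. \<not> (\<exists>r0>0. \<forall>r. 0 < r \<longrightarrow> r < r0 \<longrightarrow> measure M (ball x r) < 1 / real (Suc n) * r powr s)"
proof (rule ccontr)
  interpret finite_measure M by fact
  assume "\<not> ?thesis"
  then have *: "\<exists>r0>0. \<forall>r. 0 < r \<longrightarrow> r < r0 \<longrightarrow> measure M (ball x r) < 1 / real (Suc n) * r powr s" for n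
    by blast
  have "upper_density s M x \<le> ennreal (1 / real (Suc n))" for n
    unfolding upper_density_def
  proof (rule Limsup_bounded)
    obtain r0 where r0: "r0 > 0"
      "\<And>r. 0 < r \<Longrightarrow> r < r0 \<Longrightarrow> measure M (ball x r) < 1 / real (Suc n) * r powr s"
      using * by blast
    have "emeasure M (ball x r) / ennreal (r powr s) \<le> ennreal (1 / real (Suc n))" if "r \<in> {0<..<r0}" for r
    proof -
      have r: "0 < r" "r < r0" using that by auto
      have "measure M (ball x r) / r powr s \<le> 1 / real (Suc n)"
        using r0(2)[OF r] r by (simp add: field_simps)
      then have "ennreal (measure M (ball x r) / r powr s) \<le> ennreal (1 / real (Suc n))"
        by (rule ennreal_leI)
      then show ?thesis using r by (simp add: emeasure_eq_measure divide_ennreal)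
    qed
    then show "\<forall>\<^sub>F r in at_right 0. emeasure M (ball x r) / ennreal (r powr s) \<le> ennreal (1 / real (Suc n))"
      by (rule eventually_at_rightI[OF _ r0(1)])
  qed
  moreover have "(\<lambda>n. ennreal (1 / real (Suc n))) \<longlonglongrightarrow> ennreal 0"
    using LIMSEQ_inverse_real_of_nat by (intro tendsto_ennrealI) (simp add: inverse_eq_divide)
  ultimately have "upper_density s M x \<le> ennreal 0"
    by (intro LIMSEQ_le_const) auto
  with pos show False by simp
qed

theorem theorem1:
  fixes s :: real and M :: "(real ^ 'm) measure" and E :: "(real ^ 'm) set"
  assumes "0 \<le> s" and "s \<le> real CARD('m)"
    and "radon_measure M" and "finite_measure M"
    and "E \<in> sets M" and "emeasure M E > 0"
    and "\<And>x. x \<in> E \<Longrightarrow> 0 < upper_density s M x \<and> upper_density s M x < \<infinity>"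
    and "\<And>x. x \<in> E \<Longrightarrow> \<exists>L. ((\<lambda>\<epsilon>. truncated_riesz s M \<epsilon> x) \<longlongrightarrow> L) (at_right 0)"
  shows "s \<in> \<int>"
proof (rule ccontr)
  assume nint: "s \<notin> \<int>"
  then have s: "0 < s" using \<open>0 \<le> s\<close> by (cases "s = 0") auto
  have sM: "sets M = sets borel" using \<open>radon_measure M\<close> by (simp add: radon_measure_def)
  note fM = \<open>finite_measure M\<close>
  define P where "P i j \<epsilon> k x \<longleftrightarrow> ((\<forall>r>0. measure M (ball x r) \<le> real (Suc i) * r powr s) \<longrightarrow>
     (\<forall>t\<ge>real k. norm (t powr ((s + 1) / 2) *\<^sub>R gauss_riesz t M x) \<le> \<epsilon>) \<longrightarrow>
     (\<exists>r0>0. \<forall>r. 0 < r \<longrightarrow> r < r0 \<longrightarrow> measure M (ball x r) < 1 / real (Suc j) * r powr s))"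
    for i j k :: nat and \<epsilon> x
  \<comment> \<open>The threshold depends only on the growth constant \<open>i\<close> and the
    density bound \<open>j\<close>. Given a point of \<open>E\<close>, these are fixed first, and
    \<open>k\<close> is then read off from the convergence of its Gaussian transforms to 0.\<close>
  have "\<exists>\<epsilon>>0. \<forall>k::nat. AE x in M. P i j \<epsilon> k x" for i j :: nat
    unfolding P_def by (rule no_good_density_point[OF s nint _ _ fM sM]) auto
  then obtain \<epsilon> where \<epsilon>: "\<And>i j. 0 < \<epsilon> i j" and AE: "\<And>i j k. AE x in M. P i j (\<epsilon> i j) k x"
    by metis
  \<comment> \<open>Countably many exceptional null sets are united; every point of \<open>E\<close>
    violates \<open>P\<close> for some triple and so lies in this union.\<close>
  have "AE x in M. \<forall>i j k. P i j (\<epsilon> i j) k x"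
    using AE by (simp only: AE_all_countable) blast
  then have "AE x in M. x \<notin> E"
  proof eventually_elim
    case (elim x)
    show ?case
    proof
      assume x: "x \<in> E"
      obtain i where i: "\<forall>r>0. measure M (ball x r) \<le> real (Suc i) * r powr s"
        using upper_density_finite_imp_growth[OF fM s] assms(7)[OF x] by blast
      obtain j where j: "\<not> (\<exists>r0>0. \<forall>r. 0 < r \<longrightarrow> r < r0 \<longrightarrow> measure M (ball x r) < 1 / real (Suc j) * r powr s)"
        using upper_density_pos_imp_frequently[OF fM] assms(7)[OF x] by blast
      obtain l where "((\<lambda>\<epsilon>. truncated_riesz s M \<epsilon> x) \<longlongrightarrow> l) (at_right 0)"
        using assms(8)[OF x] by blast
      from tendstoD[OF principal_value_imp_gauss_riesz[OF fM sM s this] \<epsilon>[of i j]]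
      obtain T where "\<And>t. t \<ge> T \<Longrightarrow> norm (t powr ((s + 1) / 2) *\<^sub>R gauss_riesz t M x) < \<epsilon> i j"
        by (auto simp: eventually_at_top_linorder dist_norm)
      moreover obtain k :: nat where "T \<le> real k" using real_arch_simple by blast
      ultimately have "\<forall>t\<ge>real k. norm (t powr ((s + 1) / 2) *\<^sub>R gauss_riesz t M x) \<le> \<epsilon> i j"
        by (meson less_imp_le order_trans)
      then show False using elim i j unfolding P_def by blast
    qed
  qed
  then have "emeasure M E = 0"
    using sets.sets_into_space[OF \<open>E \<in> sets M\<close>]
    by (subst (asm) AE_iff_measurable[OF \<open>E \<in> sets M\<close>]) auto
  with \<open>emeasure M E > 0\<close> show False by simp
qed

end
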